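(* Let $(\mathbb{R}^n,g)$ be a $C^\infty$ Riemannian manifold and let $U\subseteq\mathbb{R}^n$ be open and geodesically convex ($g$-convex) with $0\in U$. Let $F\in C^{0}(U;\mathbb{R}^n)$ be a complete vector field on $U$ giving rise to $\dot{x}=F(x)$, with $0$ globally asymptotically stable (GAS) on $U$ under $F$. If there is a $g$-convex $C^{\infty}$ Lyapunov function $V:U\to\mathbb{R}_{\geq 0}$ asserting that $0$ is GAS, then $F$ is straight-line homotopic to the vector field $\mathrm{Exp}^{-1}(0)$, $x\mapsto\mathrm{Exp}_x^{-1}(0)$, on $U$ such that $0$ is GAS throughout the homotopy; that is, the map $H:[0,1]\times U\to\mathbb{R}^n$, $H(s,x):=(1-s)F(x)+s\,\mathrm{Exp}_x^{-1}(0)$, is continuous and for every $s\in[0,1]$ the point $0$ is GAS on $U$ under $H(s,\cdot)$.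
   Context: Geodesics are with respect to the Riemannian metric $g$ (extremals of the energy functional $E(\gamma)=\tfrac12\int_{[0,1]}\langle\dot\gamma(\tau),\dot\gamma(\tau)\rangle_g\,\mathrm{d}\tau$). A subset $U\subseteq\mathbb{R}^n$ is $g$-convex if for all $x,y\in U$ there is a unique geodesic $\gamma:[0,1]\to\mathbb{R}^n$ connecting $x$ to $y$ such that $\gamma([0,1])\subseteq U$. A function $f:U\to\mathbb{R}$ on a $g$-convex set $U$ is $g$-convex if $(1-t)f(x)+tf(y)\geq f(\gamma(t))$ for all $x,y\in U$ and $t\in[0,1]$, where $\gamma:[0,1]\to U$ is the geodesic connecting $x$ to $y$. $\mathrm{Exp}_x$ is the Riemannian exponential map at $x$: $\mathrm{Exp}_x(v)=\gamma(1)$ for $\gamma$ the geodesic with $\gamma(0)=x$, $\dot\gamma(0)=v$. For $x\in U$, $\mathrm{Exp}_x^{-1}(0)\in T_x\mathbb{R}^n\simeq\mathbb{R}^n$ is the initial velocity $\dot\gamma(0)$ of the unique geodesic $\gamma:[0,1]\to U$ with $\gamma(0)=x$ and $\gamma(1)=0$. A continuous vector field $F$ on $U$ is complete if it induces a continuous global flow $\mathbb{R}\times U\to U$. For a continuous vector field $G$ on $U$ with $G(0)=0$, the point $0$ is GAS on $U$ under $G$ if (i) for every open neighbourhood $U_\varepsilon\subseteq U$ of $0$ there is an open neighbourhood $U_\delta\subseteq U_\varepsilon$ of $0$ such that every solution of $\dot x=G(x)$ starting in $U_\delta$ at time $0$ stays in $U_\varepsilon$ for all forward times; and (ii) for every $x_0\in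 U$, every maximal forward solution in $U$ with $x(0)=x_0$ is defined for all $t\geq 0$ and converges to $0$ as $t\to+\infty$. A $C^\infty$ Lyapunov function on $U$ with respect to $F$ and $0$ is $V\in C^\infty(U;\mathbb{R}_{\geq 0})$ with (a) $V(0)=0$ and $V(x)>0$ for $x\in U\setminus\{0\}$; (b) $\langle\nabla V(x),F(x)\rangle<0$ for all $x\in U\setminus\{0\}$ (Euclidean inner product and gradient); (c) $V$ is proper: for every $c\geq 0$ the sub-level set $\{x\in U:V(x)\leq c\}$ is compact (for $U=\mathbb{R}^n$ this is $V(x)\to+\infty$ as $\|x\|\to+\infty$). *)

theory Defs
  imports "HOL-Analysis.Analysis"
begin

text \<open>Points and tangent vectors are both elements of the ambient Euclidean space. All domains
  of smoothness below are open, so the unrestricted filter \<^term>\<open>at x\<close> is the right one.\<close>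

fun Ck_on :: "nat \<Rightarrow> ('a::euclidean_space \<Rightarrow> 'b::real_normed_vector) \<Rightarrow> 'a set \<Rightarrow> bool" where
  "Ck_on 0 f U \<longleftrightarrow> continuous_on U f"
| "Ck_on (Suc k) f U \<longleftrightarrow>
     (\<forall>x\<in>U. f differentiable (at x)) \<and>
     (\<forall>v. Ck_on k (\<lambda>x. frechet_derivative f (at x) v) U)"

definition Cinfinity_on :: "('a::euclidean_space \<Rightarrow> 'b::real_normed_vector) \<Rightarrow> 'a set \<Rightarrow> bool" where
  "Cinfinity_on f U \<longleftrightarrow> (\<forall>k. Ck_on k f U)"

text \<open>A metric is a field of inner products: \<^term>\<open>g x u v\<close> is the inner product of the
  tangent vectors \<^term>\<open>u\<close> and \<^term>\<open>v\<close> at \<^term>\<open>x\<close>.\<close>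

definition riemannian_metric :: "('a::euclidean_space \<Rightarrow> 'a \<Rightarrow> 'a \<Rightarrow> real) \<Rightarrow> bool" where
  "riemannian_metric g \<longleftrightarrow>
     (\<forall>x. bilinear (g x)) \<and>
     (\<forall>x u v. g x u v = g x v u) \<and>
     (\<forall>x u. u \<noteq> 0 \<longrightarrow> g x u u > 0) \<and>
     (\<forall>u v. Cinfinity_on (\<lambda>x. g x u v) UNIV)"

text \<open>Curves live on \<^term>\<open>{0..1::real}\<close>; the values outside are irrelevant, whence the derivatives
  within the interval (one-sided at the end points) and, later on, uniqueness of
  curves only up to equality on the interval.\<close>

definition velocity :: "(real \<Rightarrow> 'a::euclidean_space) \<Rightarrow> real \<Rightarrow> 'a" where
  "velocity \<gamma> t = vector_derivative \<gamma> (at t within {0..1})"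

definition C1_curve :: "(real \<Rightarrow> 'a::euclidean_space) \<Rightarrow> bool" where
  "C1_curve \<gamma> \<longleftrightarrow>
     (\<forall>t\<in>{0..1}. \<gamma> differentiable (at t within {0..1})) \<and>
     continuous_on {0..1} (velocity \<gamma>)"

definition energy :: "('a::euclidean_space \<Rightarrow> 'a \<Rightarrow> 'a \<Rightarrow> real) \<Rightarrow> (real \<Rightarrow> 'a) \<Rightarrow> real" where
  "energy g \<gamma> = 1/2 * integral {0..1} (\<lambda>\<tau>. g (\<gamma> \<tau>) (velocity \<gamma> \<tau>) (velocity \<gamma> \<tau>))"

text \<open>Extremals of the energy: the first variation vanishes for all variations that fix
  the end points.\<close>

definition geodesic :: "('a::euclidean_space \<Rightarrow> 'a \<Rightarrow> 'a \<Rightarrow> real) \<Rightarrow> (real \<Rightarrow> 'a) \<Rightarrow> bool" where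
  "geodesic g \<gamma> \<longleftrightarrow>
     C1_curve \<gamma> \<and>
     (\<forall>\<eta>. C1_curve \<eta> \<and> \<eta> 0 = 0 \<and> \<eta> 1 = 0 \<longrightarrow>
        ((\<lambda>s. energy g (\<lambda>t. \<gamma> t + s *\<^sub>R \<eta> t)) has_real_derivative 0) (at 0))"

definition geodesic_in ::
    "('a::euclidean_space \<Rightarrow> 'a \<Rightarrow> 'a \<Rightarrow> real) \<Rightarrow> 'a set \<Rightarrow> 'a \<Rightarrow> 'a \<Rightarrow> (real \<Rightarrow> 'a) \<Rightarrow> bool" where
  "geodesic_in g U x y \<gamma> \<longleftrightarrow>
     geodesic g \<gamma> \<and> \<gamma> 0 = x \<and> \<gamma> 1 = y \<and> \<gamma> ` {0..1} \<subseteq> U"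

definition g_convex_set :: "('a::euclidean_space \<Rightarrow> 'a \<Rightarrow> 'a \<Rightarrow> real) \<Rightarrow> 'a set \<Rightarrow> bool" where
  "g_convex_set g U \<longleftrightarrow>
     (\<forall>x\<in>U. \<forall>y\<in>U. \<exists>\<gamma>. geodesic_in g U x y \<gamma> \<and>
        (\<forall>\<gamma>'. geodesic_in g U x y \<gamma>' \<longrightarrow> (\<forall>t\<in>{0..1}. \<gamma>' t = \<gamma> t)))"

definition g_convex_fun ::
    "('a::euclidean_space \<Rightarrow> 'a \<Rightarrow> 'a \<Rightarrow> real) \<Rightarrow> 'a set \<Rightarrow> ('a \<Rightarrow> real) \<Rightarrow> bool" where
  "g_convex_fun g U f \<longleftrightarrow>
     (\<forall>x\<in>U. \<forall>y\<in>U. \<forall>\<gamma>. geodesic_in g U x y \<gamma> \<longrightarrow>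
        (\<forall>t\<in>{0..1}. (1 - t) * f x + t * f y \<ge> f (\<gamma> t)))"

text \<open>The inverse exponential map at \<^term>\<open>x\<close>, relative to \<^term>\<open>U\<close>: the initial velocity of the
  geodesic inside \<^term>\<open>U\<close> from \<^term>\<open>x\<close> to \<^term>\<open>y\<close>, well defined if \<^term>\<open>U\<close> is g-convex.\<close>

definition Exp_inv ::
    "('a::euclidean_space \<Rightarrow> 'a \<Rightarrow> 'a \<Rightarrow> real) \<Rightarrow> 'a set \<Rightarrow> 'a \<Rightarrow> 'a \<Rightarrow> 'a" where
  "Exp_inv g U x y = (THE v. \<exists>\<gamma>. geodesic_in g U x y \<gamma> \<and> velocity \<gamma> 0 = v)"

definition complete_field :: "'a::euclidean_space set \<Rightarrow> ('a \<Rightarrow> 'a) \<Rightarrow> bool" where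
  "complete_field U F \<longleftrightarrow>
     (\<exists>\<phi> :: real \<Rightarrow> 'a \<Rightarrow> 'a.
        continuous_on (UNIV \<times> U) (\<lambda>(t, x). \<phi> t x) \<and>
        (\<forall>t. \<forall>x\<in>U. \<phi> t x \<in> U) \<and>
        (\<forall>x\<in>U. \<phi> 0 x = x) \<and>
        (\<forall>s t. \<forall>x\<in>U. \<phi> (s + t) x = \<phi> s (\<phi> t x)) \<and>
        (\<forall>t. \<forall>x\<in>U. ((\<lambda>\<tau>. \<phi> \<tau> x) has_vector_derivative F (\<phi> t x)) (at t)))"

text \<open>Solutions of a merely continuous field need not be unique, so solutions carry their
  time interval \<^term>\<open>J\<close> explicitly.\<close>

definition forward_solution ::
    "'a::euclidean_space set \<Rightarrow> ('a \<Rightarrow> 'a) \<Rightarrow> real set \<Rightarrow> (real \<Rightarrow> 'a) \<Rightarrow> bool" where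
  "forward_solution U G J x \<longleftrightarrow>
     is_interval J \<and> 0 \<in> J \<and> J \<subseteq> {0..} \<and>
     (\<forall>t\<in>J. x t \<in> U \<and> (x has_vector_derivative G (x t)) (at t within J))"

definition maximal_forward_solution ::
    "'a::euclidean_space set \<Rightarrow> ('a \<Rightarrow> 'a) \<Rightarrow> real set \<Rightarrow> (real \<Rightarrow> 'a) \<Rightarrow> bool" where
  "maximal_forward_solution U G J x \<longleftrightarrow>
     forward_solution U G J x \<and>
     (\<forall>J' y. forward_solution U G J' y \<and> J \<subseteq> J' \<and> (\<forall>t\<in>J. y t = x t) \<longrightarrow> J' = J)"

definition GAS_zero :: "'a::euclidean_space set \<Rightarrow> ('a \<Rightarrow> 'a) \<Rightarrow> bool" where
  "GAS_zero U G \<longleftrightarrow>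
     continuous_on U G \<and> G 0 = 0 \<and>
     (\<forall>U\<epsilon>. open U\<epsilon> \<and> 0 \<in> U\<epsilon> \<and> U\<epsilon> \<subseteq> U \<longrightarrow>
        (\<exists>U\<delta>. open U\<delta> \<and> 0 \<in> U\<delta> \<and> U\<delta> \<subseteq> U\<epsilon> \<and>
           (\<forall>J x. forward_solution U G J x \<and> x 0 \<in> U\<delta> \<longrightarrow> (\<forall>t\<in>J. x t \<in> U\<epsilon>)))) \<and>
     (\<forall>J x. maximal_forward_solution U G J x \<longrightarrow> J = {0..} \<and> (x \<longlongrightarrow> 0) at_top)"

definition gradient :: "('a::euclidean_space \<Rightarrow> real) \<Rightarrow> 'a \<Rightarrow> 'a" where
  "gradient f x = (THE D. GDERIV f x :> D)"

definition smooth_Lyapunov ::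
    "'a::euclidean_space set \<Rightarrow> ('a \<Rightarrow> 'a) \<Rightarrow> ('a \<Rightarrow> real) \<Rightarrow> bool" where
  "smooth_Lyapunov U F V \<longleftrightarrow>
     Cinfinity_on V U \<and> (\<forall>x\<in>U. V x \<ge> 0) \<and>
     V 0 = 0 \<and> (\<forall>x\<in>U - {0}. V x > 0) \<and>
     (\<forall>x\<in>U - {0}. gradient V x \<bullet> F x < 0) \<and>
     (\<forall>c\<ge>0. compact {x\<in>U. V x \<le> c})"

end

theory Submission
  imports Defs "HOL-Complex_Analysis.Great_Picard"
begin

text \<open>For a geodesic \<open>c\<close> from \<open>x\<close> to \<open>0\<close>, convexity gives \<open>V (c t) \<le> (1 - t) V x\<close>, so the derivative of
  \<open>V\<close> in the direction \<open>c' 0 = Exp_inv g U x 0\<close> is at most \<open>- V x\<close>. Hence \<open>V\<close> decreases strictly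
  along every convex combination of \<open>F\<close> and \<open>Exp_inv\<close>, and Lyapunov's theorem applies; as these
  fields are merely continuous, Peano's theorem is needed to extend solutions.

  The remaining point is the continuity of \<open>Exp_inv\<close>. By convexity the geodesics to \<open>0\<close> that start in a
  sub-level set \<open>K\<close> of \<open>V\<close> stay in the compact set \<open>K\<close>. Their speeds are bounded: a very long geodesic
  in \<open>K\<close> passes twice through one of finitely many small balls, and two points of a small ball are
  also joined by a short geodesic, against uniqueness. By Arzela-Ascoli these geodesics form a compact
  family, and uniqueness shows that the graph of \<open>Exp_inv\<close> over \<open>K\<close> is closed.\<close>

subsection \<open>Existence of solutions of continuous differential equations\<close>

text \<open>Extremals are only C1 by definition, whereas speeds, limits and short geodesics are
  handled through the second-order equation. The du Bois-Reymond argument supplies the missing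
  derivative, and the first variation leads back, so that every solution of the equation inside
  \<open>U\<close> is subject to the uniqueness clause of \<open>g_convex_set\<close>. Nothing in
  that clause bounds velocities by itself: along a convergent sequence of starting points the
  initial velocities could escape to infinity. What makes uniqueness yield a bound is that all
  curves are parametrised by {0..1}: an arc stretched to {0..1} and a short geodesic with the same
  ends must agree in speed as well as in shape. One compactness lemma for approximate integral
  curves serves twice, for the delayed approximations in Peano's theorem and, with error 0, for
  sequences of geodesics.\<close>

lemma approximate_solutions_limit:
  fixes f :: "'a::euclidean_space \<Rightarrow> 'a" and z :: "nat \<Rightarrow> real \<Rightarrow> 'a"
  assumes cont: "continuous_on Z f" and Z: "compact Z"
    and zZ: "\<And>n t. t \<in> {0..1} \<Longrightarrow> z n t \<in> Z"
    and lip: "\<And>n. L-lipschitz_on {0..1} (z n)"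
    and err: "\<And>n t. t \<in> {0..1} \<Longrightarrow> norm (z n t - (z n 0 + integral {0..t} (\<lambda>s. f (z n s)))) \<le> e n"
    and e: "e \<longlonglongrightarrow> 0"
  obtains w r where "strict_mono r" "\<forall>t\<in>{0..1}. (\<lambda>n. z (r n) t) \<longlonglongrightarrow> w t"
    "\<forall>t\<in>{0..1}. w t \<in> Z"
    "\<forall>t\<in>{0..1}. (w has_vector_derivative f (w t)) (at t within {0..1})"
proof -
  obtain M where M: "\<And>x. x \<in> Z \<Longrightarrow> norm x \<le> M"
    using compact_imp_bounded[OF Z] by (auto simp: bounded_iff)
  have L0: "L \<ge> 0"
    using lip[of 0] by (rule lipschitz_on_nonneg)
  have equi: "\<exists>d>0. \<forall>n y. y \<in> {0..1} \<and> norm (x - y) < d \<longrightarrow> norm (z n x - z n y) < \<epsilon>"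
    if "x \<in> {0..1}" "\<epsilon> > 0" for x \<epsilon> :: real
  proof (intro exI[of _ "\<epsilon> / (L + 1)"] conjI allI impI)
    fix n y assume y: "y \<in> {0..1} \<and> norm (x - y) < \<epsilon> / (L + 1)"
    have "norm (z n x - z n y) \<le> L * norm (x - y)"
      using lipschitz_on_normD[OF lip that(1)] y by blast
    also have "\<dots> \<le> (L + 1) * norm (x - y)" by (simp add: algebra_simps)
    also have "\<dots> < \<epsilon>" using y L0 by (simp add: pos_less_divide_eq mult.commute)
    finally show "norm (z n x - z n y) < \<epsilon>" .
  qed (use that L0 in auto)
  obtain w r where w: "continuous_on {0..1} w" and r: "strict_mono (r :: nat \<Rightarrow> nat)"
    and u: "\<And>\<epsilon>. 0 < \<epsilon> \<Longrightarrow> \<exists>N. \<forall>n x. n \<ge> N \<and> x \<in> {0..1} \<longrightarrow> norm (z (r n) x - w x) < \<epsilon>"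
    using Arzela_Ascoli[of "{0..1::real}" z M] M zZ equi by (metis compact_Icc)
  have ul: "uniform_limit {0..1} (\<lambda>n. z (r n)) w sequentially"
    unfolding uniform_limit_sequentially_iff dist_norm using u by meson
  have pt: "(\<lambda>n. z (r n) t) \<longlonglongrightarrow> w t" if "t \<in> {0..1}" for t
    using tendsto_uniform_limitI[OF ul that] .
  have wZ: "w t \<in> Z" if "t \<in> {0..1}" for t
    using closed_sequentially[OF compact_imp_closed[OF Z] _ pt[OF that]] zZ[OF that] by auto
  \<comment> \<open>On the compact set \<open>Z\<close> the field is uniformly continuous, so
    uniform convergence of the curves carries over to \<open>f\<close> along them and then to the
    integrals.\<close>
  have ulf: "uniform_limit {0..1} (\<lambda>n t. f (z (r n) t)) (\<lambda>t. f (w t)) sequentially"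
    by (rule uniform_limit_compose_uniformly_continuous_on[OF ul
          compact_uniformly_continuous[OF cont Z]])
       (use zZ Z in \<open>auto intro: compact_imp_closed\<close>)
  have contfz: "continuous_on {0..1} (\<lambda>t. f (z n t))" for n
    by (rule continuous_on_compose2[OF cont lipschitz_on_continuous_on[OF lip]]) (use zZ in auto)
  \<comment> \<open>Derivatives need not converge, but the integral equation survives the limit
    because the errors vanish; differentiating it recovers the derivative of
    \<open>w\<close>.\<close>
  have eq: "w t = w 0 + integral {0..t} (\<lambda>s. f (w s))" if t: "t \<in> {0..1}" for t
  proof -
    have sub: "{0..t} \<subseteq> {0..1}" using t by auto
    obtain I J where I: "\<And>n. ((\<lambda>s. f (z (r n) s)) has_integral I n) {0..t}"
      and J: "((\<lambda>s. f (w s)) has_integral J) {0..t}" and IJ: "I \<longlonglongrightarrow> J"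
      by (rule uniform_limit_integral[OF uniform_limit_on_subset[OF ulf sub]
            continuous_on_subset[OF contfz sub] sequentially_bot]) blast
    have "(\<lambda>n. z (r n) t - (z (r n) 0 + I n)) \<longlonglongrightarrow> w t - (w 0 + J)"
      by (intro tendsto_intros pt IJ t) auto
    moreover have "(\<lambda>n. z (r n) t - (z (r n) 0 + I n)) \<longlonglongrightarrow> 0"
    proof (rule Lim_null_comparison)
      show "\<forall>\<^sub>F n in sequentially. norm (z (r n) t - (z (r n) 0 + I n)) \<le> e (r n)"
        using err[OF t, of "r _"] integral_unique[OF I] by simp
      show "(\<lambda>n. e (r n)) \<longlonglongrightarrow> 0"
        using LIMSEQ_subseq_LIMSEQ[OF e r] by (simp add: o_def)
    qed
    ultimately have "w t - (w 0 + J) = 0" by (rule LIMSEQ_unique)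
    then show ?thesis using J by (simp add: integral_unique)
  qed
  have contfw: "continuous_on {0..1} (\<lambda>t. f (w t))"
    by (rule continuous_on_compose2[OF cont w]) (use wZ in auto)
  have "(w has_vector_derivative f (w t)) (at t within {0..1})" if t: "t \<in> {0..1}" for t
  proof -
    have "((\<lambda>u. w 0 + integral {0..u} (\<lambda>s. f (w s))) has_vector_derivative 0 + f (w t)) (at t within {0..1})"
      by (intro derivative_intros integral_has_vector_derivative contfw t)
    then show ?thesis
      using has_vector_derivative_transform[OF t eq] by simp
  qed
  then show thesis using that r pt wZ by blast
qed

text \<open>Tonelli's scheme: the iterates of the integral operator with delay \<open>h\<close> become stationary
  on \<open>{0..1}\<close>, and the stationary function solves the equation up to an error of order \<open>h\<close>.\<close>

lemma peano_bounded:
  fixes f :: "'a::euclidean_space \<Rightarrow> 'a"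
  assumes cont: "continuous_on UNIV f" and bd: "\<And>x. norm (f x) \<le> M"
  obtains x where "x 0 = x0"
    "\<And>t. t \<in> {0..1} \<Longrightarrow> (x has_vector_derivative f (x t)) (at t within {0..1})"
proof -
  have M0: "M \<ge> 0" using bd[of 0] norm_ge_zero order_trans by blast
  \<comment> \<open>For \<open>t \<le> h\<close> the value is \<open>x0\<close>; later values depend
    on \<open>y\<close> only up to time \<open>t - h\<close>.\<close>
  define T :: "real \<Rightarrow> (real \<Rightarrow> 'a) \<Rightarrow> (real \<Rightarrow> 'a)"
    where "T h y t = x0 + integral {0..max 0 (t - h)} (\<lambda>s. f (y s))" for h y t
  have int: "(\<lambda>s. f (y s)) integrable_on {a..b}" if "continuous_on UNIV y" for y :: "real \<Rightarrow> 'a" and a b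
    by (intro integrable_continuous_real continuous_on_compose2[OF cont]
        continuous_on_subset[OF that]) auto
  have diff: "norm (integral {0..b} (\<lambda>s. f (y s)) - integral {0..a} (\<lambda>s. f (y s))) \<le> M * \<bar>b - a\<bar>"
    if y: "continuous_on UNIV y" and ab: "0 \<le> a" "0 \<le> b" for y :: "real \<Rightarrow> 'a" and a b
  proof -
    have *: "norm (integral {0..d} (\<lambda>s. f (y s)) - integral {0..c} (\<lambda>s. f (y s))) \<le> M * (d - c)"
      if "0 \<le> c" "c \<le> d" for c d
    proof -
      have "integral {0..c} (\<lambda>s. f (y s)) + integral {c..d} (\<lambda>s. f (y s)) = integral {0..d} (\<lambda>s. f (y s))"
        by (rule Henstock_Kurzweil_Integration.integral_combine) (use that int[OF y] in auto)
      then have "integral {0..d} (\<lambda>s. f (y s)) - integral {0..c} (\<lambda>s. f (y s)) = integral {c..d} (\<lambda>s. f (y s))"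
        by (simp add: algebra_simps)
      also have "norm \<dots> \<le> M * (d - c)"
        by (rule integral_bound) (use that bd in \<open>auto intro!: continuous_on_compose2[OF cont] continuous_on_subset[OF y]\<close>)
      finally show ?thesis .
    qed
    show ?thesis
      using *[of a b] *[of b a] ab by (cases "a \<le> b") (auto simp: norm_minus_commute abs_if)
  qed
  have lipT: "M-lipschitz_on UNIV (T h y)" if y: "continuous_on UNIV y" for h y
  proof (rule lipschitz_onI)
    fix s t :: real
    have "dist (T h y s) (T h y t) \<le> M * \<bar>max 0 (s - h) - max 0 (t - h)\<bar>"
      unfolding T_def dist_norm using diff[OF y, of "max 0 (t - h)" "max 0 (s - h)"] by simp
    also have "\<dots> \<le> M * dist s t"
      by (intro mult_left_mono M0) (auto simp: dist_real_def)
    finally show "dist (T h y s) (T h y t) \<le> M * dist s t" .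
  qed (rule M0)
  define X where "X h k = ((T h) ^^ k) (\<lambda>_. x0)" for h k
  have X_Suc: "X h (Suc k) = T h (X h k)" for h k by (simp add: X_def)
  have lipX: "M-lipschitz_on UNIV (X h k)" for h k
  proof (induction k)
    case 0 show ?case using lipschitz_on_mono[OF lipschitz_on_constant subset_UNIV M0] by (simp add: X_def)
  next
    case (Suc k) then show ?case unfolding X_Suc by (intro lipT lipschitz_on_continuous_on)
  qed
  note contX = lipschitz_on_continuous_on[OF lipX]
  \<comment> \<open>The delay makes this an induction in steps of length \<open>h\<close>: if two
    iterates agree up to time \<open>k * h\<close>, their images agree up to
    \<open>(k + 1) * h\<close>.\<close>
  have stat: "X h (Suc k) t = X h k t" if "0 < h" "t \<le> real k * h" for h k t
    using that(2)
  proof (induction k arbitrary: t)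
    case 0 then show ?case using that(1) by (simp add: X_def T_def)
  next
    case (Suc k)
    have "X h (Suc (Suc k)) t = x0 + integral {0..max 0 (t - h)} (\<lambda>s. f (X h (Suc k) s))"
      by (simp add: X_Suc[of h "Suc k"] T_def)
    also have "integral {0..max 0 (t - h)} (\<lambda>s. f (X h (Suc k) s)) = integral {0..max 0 (t - h)} (\<lambda>s. f (X h k s))"
    proof (rule Henstock_Kurzweil_Integration.integral_cong)
      fix s assume "s \<in> {0..max 0 (t - h)}"
      moreover have "0 \<le> real k * h" using that(1) by simp
      moreover have "t - h \<le> real k * h" using Suc.prems by (simp add: algebra_simps)
      ultimately have "s \<le> real k * h" by auto
      then show "f (X h (Suc k) s) = f (X h k s)" using Suc.IH by simp
    qed
    also have "x0 + \<dots> = X h (Suc k) t" by (simp add: X_Suc T_def)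
    finally show ?case .
  qed
  \<comment> \<open>With delay \<open>1 / (n + 1)\<close>, exactly \<open>n + 1\<close> iterations
    are stationary up to time 1.\<close>
  define z where "z n = X (1 / real (Suc n)) (Suc n)" for n
  have z0: "z n 0 = x0" for n by (simp add: z_def X_Suc T_def)
  have lipz: "M-lipschitz_on {0..1} (z n)" for n
    unfolding z_def using lipX by (rule lipschitz_on_subset) auto
  have contz: "continuous_on UNIV (z n)" for n unfolding z_def by (rule contX)
  define Z where "Z = cball x0 M"
  have zZ: "z n t \<in> Z" if "t \<in> {0..1}" for n t
  proof -
    have "dist (z n 0) (z n t) \<le> M * dist 0 t"
      using lipschitz_onD[OF lipz[of n], of 0 t] that by auto
    also have "\<dots> \<le> M * 1" using that M0 by (intro mult_left_mono) auto
    finally show ?thesis by (simp add: Z_def z0)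
  qed
  have zT: "z n t = T (1 / real (Suc n)) (z n) t" if "t \<in> {0..1}" for n t
    using stat[of "1 / real (Suc n)" t "Suc n"] that unfolding z_def X_Suc[of _ "Suc n"] by simp
  have err: "norm (z n t - (z n 0 + integral {0..t} (\<lambda>s. f (z n s)))) \<le> M / real (Suc n)"
    if t: "t \<in> {0..1}" for n t
  proof -
    have "norm (z n t - (z n 0 + integral {0..t} (\<lambda>s. f (z n s))))
      = norm (integral {0..max 0 (t - 1 / real (Suc n))} (\<lambda>s. f (z n s)) - integral {0..t} (\<lambda>s. f (z n s)))"
      by (subst zT[OF t]) (simp add: T_def z0)
    also have "\<dots> \<le> M * \<bar>max 0 (t - 1 / real (Suc n)) - t\<bar>"
      by (rule diff[OF contz]) (use t in auto)
    also have "\<dots> \<le> M * (1 / real (Suc n))"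
      by (intro mult_left_mono M0) (use t in \<open>auto simp: max_def\<close>)
    finally show ?thesis by simp
  qed
  have "(\<lambda>n. M / real (Suc n)) \<longlonglongrightarrow> 0"
    using tendsto_mult[OF tendsto_const[of M] LIMSEQ_inverse_real_of_nat] by (simp add: divide_inverse)
  moreover have "continuous_on Z f" using cont by (rule continuous_on_subset) auto
  moreover have "compact Z" by (simp add: Z_def)
  ultimately obtain w r where r: "strict_mono r"
    and lim: "\<forall>t\<in>{0..1}. (\<lambda>n. z (r n) t) \<longlonglongrightarrow> w t"
    and w: "\<forall>t\<in>{0..1}. (w has_vector_derivative f (w t)) (at t within {0..1})"
    using approximate_solutions_limit[of Z f z M, OF _ _ zZ lipz err] by metis
  have "w 0 = x0"
    using LIMSEQ_unique[OF bspec[OF lim, of 0]] z0 by auto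
  then show thesis using that w by blast
qed

text \<open>Composition with the closest-point projection onto a closed ball in \<open>U\<close>
  turns \<open>G\<close> into a bounded continuous field on the whole space. Its solution solves the
  original equation as long as it stays in the ball, which continuity ensures for a short
  time.\<close>

lemma peano_local:
  fixes G :: "'a::euclidean_space \<Rightarrow> 'a"
  assumes U: "open U" and cont: "continuous_on U G" and x0: "x0 \<in> U"
  obtains x h where "0 < h" "h \<le> 1" "x 0 = x0" "\<And>t. t \<in> {0..h} \<Longrightarrow> x t \<in> U"
    "\<And>t. t \<in> {0..h} \<Longrightarrow> (x has_vector_derivative G (x t)) (at t within {0..h})"
proof -
  obtain \<rho> where \<rho>: "\<rho> > 0" "cball x0 \<rho> \<subseteq> U"
    using U x0 by (meson open_contains_cball)
  define P where "P = closest_point (cball x0 \<rho>)"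
  have P: "continuous_on UNIV P" unfolding P_def
    by (rule continuous_on_closest_point) (use \<rho> in auto)
  have Pin: "P x \<in> cball x0 \<rho>" for x
    unfolding P_def by (rule closest_point_in_set) (use \<rho> in auto)
  have Pid: "P x = x" if "x \<in> cball x0 \<rho>" for x
    unfolding P_def using that by (rule closest_point_self)
  have cG: "continuous_on (cball x0 \<rho>) G" using cont \<rho>(2) by (rule continuous_on_subset)
  have f: "continuous_on UNIV (\<lambda>x. G (P x))"
    by (rule continuous_on_compose2[OF cG P]) (use Pin in auto)
  have "bounded (G ` cball x0 \<rho>)"
    by (intro compact_imp_bounded compact_continuous_image cG) auto
  then obtain M where M: "\<And>y. y \<in> cball x0 \<rho> \<Longrightarrow> norm (G y) \<le> M" unfolding bounded_iff by blast
  obtain x where x: "x 0 = x0"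
    "\<And>t. t \<in> {0..1} \<Longrightarrow> (x has_vector_derivative G (P (x t))) (at t within {0..1})"
    using peano_bounded[OF f] M Pin by blast
  have "continuous_on {0..1} x"
    using x(2) continuous_on_eq_continuous_within has_vector_derivative_continuous by blast
  then obtain d where d: "d > 0" "\<And>t. t \<in> {0..1} \<Longrightarrow> dist t 0 < d \<Longrightarrow> dist (x t) (x 0) < \<rho>"
    using \<rho>(1) unfolding continuous_on_iff by (metis atLeastAtMost_iff order_refl zero_le_one)
  define h where "h = min 1 (d / 2)"
  have h: "0 < h" "h \<le> 1" "h < d" using d by (auto simp: h_def)
  have inb: "x t \<in> cball x0 \<rho>" if "t \<in> {0..h}" for t
    using d(2)[of t] that h x(1) by (auto simp: dist_commute less_imp_le)
  have "(x has_vector_derivative G (x t)) (at t within {0..h})" if "t \<in> {0..h}" for t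
    using has_vector_derivative_within_subset[OF x(2)[of t], of "{0..h}"] that h Pid[OF inb[OF that]] by auto
  then show thesis using that h x(1) inb \<rho>(2) by blast
qed

subsection \<open>Lyapunov's theorem\<close>

text \<open>Peano's theorem restarts the solution at \<open>x b\<close>. The glued curve is
  differentiable at \<open>b\<close> because both one-sided derivatives equal
  \<open>G (x b)\<close>.\<close>

lemma forward_solution_extend:
  assumes U: "open U" and G: "continuous_on U G"
    and sol: "forward_solution U G {0..b} x" and b: "b \<ge> 0"
  obtains h y where "h > 0" "forward_solution U G {0..b + h} y" "\<And>t. t \<in> {0..b} \<Longrightarrow> y t = x t"
proof -
  have xU: "x b \<in> U" using sol b by (auto simp: forward_solution_def)
  obtain w h where h: "0 < h" and w0: "w 0 = x b" and wU: "\<And>t. t \<in> {0..h} \<Longrightarrow> w t \<in> U"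
    and w: "\<And>t. t \<in> {0..h} \<Longrightarrow> (w has_vector_derivative G (w t)) (at t within {0..h})"
    using peano_local[OF U G xU] by metis
  define y where "y t = (if t \<le> b then x t else w (t - b))" for t
  have wshift: "((\<lambda>t. w (t - b)) has_vector_derivative G (w (t - b))) (at t within {b..b+h})"
    if "t \<in> {b..b+h}" for t
  proof -
    have "((w \<circ> (\<lambda>t. t - b)) has_vector_derivative (1 *\<^sub>R G (w (t - b)))) (at t within {b..b+h})"
    proof (rule vector_diff_chain_within)
      show "((\<lambda>t. t - b) has_vector_derivative 1) (at t within {b..b+h})"
        by (auto intro!: derivative_eq_intros)
      have im: "(\<lambda>t. t - b) ` {b..b+h} = {0..h}" by (auto simp: image_iff intro!: bexI[of _ "_ + b"])
      show "(w has_vector_derivative G (w (t - b))) (at (t - b) within (\<lambda>t. t - b) ` {b..b+h})"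
        unfolding im by (rule w) (use that in auto)
    qed
    then show ?thesis by (simp add: o_def)
  qed
  have xd: "(x has_vector_derivative G (x t)) (at t within {0..b})" if "t \<in> {0..b}" for t
    using sol that by (auto simp: forward_solution_def)
  have sets: "{0..b+h} = {0..b} \<union> {b..b+h}"
    and cl: "{0..b} \<union> closure {0..b} \<inter> closure {b..b+h} = {0..b}"
      "{b..b+h} \<union> closure {0..b} \<inter> closure {b..b+h} = {b..b+h}"
    using b h by auto
  have "(y has_vector_derivative G (y t)) (at t within {0..b+h})" if t: "t \<in> {0..b+h}" for t
  proof -
    have "((\<lambda>t. if t \<in> {0..b} then x t else w (t - b)) has_vector_derivative
        (if t \<in> {0..b} then G (x t) else G (w (t - b)))) (at t within {0..b+h})"
    proof (rule has_vector_derivative_If_within_closures[OF _ sets])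
      show "t \<in> {0..b} \<union> closure {0..b} \<inter> closure {b..b+h} \<Longrightarrow>
        (x has_vector_derivative G (x t)) (at t within {0..b} \<union> closure {0..b} \<inter> closure {b..b+h})"
        unfolding cl by (rule xd)
      show "t \<in> {b..b+h} \<union> closure {0..b} \<inter> closure {b..b+h} \<Longrightarrow>
        ((\<lambda>t. w (t - b)) has_vector_derivative G (w (t - b)))
          (at t within {b..b+h} \<union> closure {0..b} \<inter> closure {b..b+h})"
        unfolding cl by (rule wshift)
      show "t \<in> {0..b} \<union> {b..b+h}" using t sets by blast
    qed (use w0 in auto)
    then have "((\<lambda>t. if t \<in> {0..b} then x t else w (t - b)) has_vector_derivative G (y t))
        (at t within {0..b+h})"
      using t by (auto simp: y_def if_distrib cong: if_cong)
    then show ?thesis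
      by (rule has_vector_derivative_transform[OF t, rotated]) (auto simp: y_def)
  qed
  moreover have "y t \<in> U" if "t \<in> {0..b+h}" for t
    using sol wU that by (auto simp: y_def forward_solution_def)
  ultimately have "forward_solution U G {0..b+h} y"
    using b h by (auto simp: forward_solution_def is_interval_cc)
  moreover have "y t = x t" if "t \<in> {0..b}" for t using that by (simp add: y_def)
  ultimately show thesis using that h by blast
qed

text \<open>On the compact set \<open>K\<close> the field is bounded, so the solution is Lipschitz
  and extends continuously to the missing end point.\<close>

lemma forward_solution_closed_extend:
  assumes G: "continuous_on U G" and K: "compact K" "K \<subseteq> U"
    and sol: "forward_solution U G {0..<b} x" and b: "b > 0" and xK: "\<And>t. t \<in> {0..<b} \<Longrightarrow> x t \<in> K"
  obtains y where "forward_solution U G {0..b} y" "\<And>t. t \<in> {0..<b} \<Longrightarrow> y t = x t"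
proof -
  have xd: "(x has_vector_derivative G (x t)) (at t within {0..<b})" if "t \<in> {0..<b}" for t
    using sol that by (auto simp: forward_solution_def)
  have cG: "continuous_on K G" using continuous_on_subset[OF G K(2)] .
  have "bounded (G ` K)" by (intro compact_imp_bounded compact_continuous_image cG K)
  then obtain M where M: "\<And>y. y \<in> K \<Longrightarrow> norm (G y) \<le> M" unfolding bounded_iff by blast
  have "norm (G (x 0)) \<le> M" using M xK b by auto
  then have M0: "M \<ge> 0" using norm_ge_zero order_trans by blast
  have lip: "M-lipschitz_on {0..<b} x"
  proof (rule lipschitz_onI[OF _ M0])
    fix s t assume st: "s \<in> {0..<b}" "t \<in> {0..<b}"
    have "norm (x s - x t) \<le> M * norm (s - t)"
      by (rule differentiable_bound[of "{0..<b}" x "\<lambda>t h. h *\<^sub>R G (x t)"])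
         (use st xd M xK in \<open>auto simp: has_vector_derivative_def intro!: onorm_le mult_left_mono
            simp: mult.commute[of M]\<close>)
    then show "dist (x s) (x t) \<le> M * dist s t" by (simp add: dist_norm)
  qed
  obtain y where y: "M-lipschitz_on (closure {0..<b}) y" and yx: "\<And>t. t \<in> {0..<b} \<Longrightarrow> y t = x t"
    using lipschitz_extend_closure[OF lip] by metis
  have cl: "closure {0..<b} = {0..b}" using b by simp
  have cy: "continuous_on {0..b} y" using lipschitz_on_continuous_on[OF y] cl by simp
  have yK: "y t \<in> K" if t: "t \<in> {0..b}" for t
  proof -
    have "y ` closure {0..<b} \<subseteq> K"
      by (rule image_closure_subset) (use cy cl yx xK K in \<open>auto intro: compact_imp_closed\<close>)
    then show ?thesis using t cl by auto
  qed
  have cGy: "continuous_on {0..b} (\<lambda>t. G (y t))"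
    by (rule continuous_on_compose2[OF cG cy]) (use yK in auto)
  \<comment> \<open>The continuous extension has no known derivative at \<open>b\<close>. The
    integral equation involves only interior derivatives, and its integrand is continuous up to
    \<open>b\<close>.\<close>
  have eq: "y t = y 0 + integral {0..t} (\<lambda>s. G (y s))" if t: "t \<in> {0..b}" for t
  proof -
    have "((\<lambda>s. G (y s)) has_integral y t - y 0) {0..t}"
    proof (rule fundamental_theorem_of_calculus_interior)
      show "continuous_on {0..t} y" by (rule continuous_on_subset[OF cy]) (use t in auto)
      fix s assume s: "s \<in> {0<..<t}"
      have "{0<..<t} \<subseteq> {0..<b}" using t by (auto intro: less_le_trans)
      then have "(x has_vector_derivative G (x s)) (at s)"
        using has_vector_derivative_within_subset[OF xd[of s], of "{0<..<t}"] s t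
          at_within_open[of s "{0<..<t}"] by auto
      then show "(y has_vector_derivative G (y s)) (at s)"
        using has_vector_derivative_transform_within_open[of x _ s "{0<..<t}" y] s t yx by auto
    qed (use t in auto)
    then show ?thesis by (simp add: integral_unique)
  qed
  have "(y has_vector_derivative G (y t)) (at t within {0..b})" if t: "t \<in> {0..b}" for t
  proof -
    have "((\<lambda>u. y 0 + integral {0..u} (\<lambda>s. G (y s))) has_vector_derivative 0 + G (y t)) (at t within {0..b})"
      by (intro derivative_intros integral_has_vector_derivative cGy t)
    then show ?thesis
      using has_vector_derivative_transform[OF t eq] by simp
  qed
  then have "forward_solution U G {0..b} y"
    using b yK K by (auto simp: forward_solution_def is_interval_cc)
  then show thesis using yx that by blast
qed

lemma nonneg_interval_cases:
  fixes J :: "real set"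
  assumes J: "is_interval J" "0 \<in> J" "J \<subseteq> {0..}"
  obtains "J = {0..}" | b where "b \<ge> 0" "J = {0..b}" | b where "b > 0" "J = {0..<b}"
proof (cases "bdd_above J")
  case False
  have "t \<in> J" if "t \<ge> 0" for t
  proof -
    obtain s where "s \<in> J" "t < s" using False by (meson bdd_above.I not_le)
    then show ?thesis using mem_is_interval_1_I[OF J(1) J(2)] that by auto
  qed
  then have "J = {0..}" using J(3) by auto
  then show thesis using that by blast
next
  case True
  define b where "b = Sup J"
  have le: "t \<le> b" if "t \<in> J" for t using True that by (simp add: b_def cSup_upper)
  have lt: "t \<in> J" if "0 \<le> t" "t < b" for t
  proof -
    have "J \<noteq> {}" using J by blast
    from less_cSupD[OF this, of t] obtain s where "s \<in> J" "t < s" using \<open>t < b\<close> b_def by blast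
    then show ?thesis using mem_is_interval_1_I[OF J(1) J(2)] that by auto
  qed
  show thesis
  proof (cases "b \<in> J")
    case True
    have "J \<subseteq> {0..b}" using le J(3) by force
    moreover have "{0..b} \<subseteq> J" using lt True by (auto simp: order_le_less)
    ultimately have "J = {0..b}" by blast
    then show ?thesis using that(2)[of b] le[OF J(2)] by blast
  next
    case False
    then have "b \<noteq> 0" using J(2) by metis
    then have "b > 0" using le[OF J(2)] by simp
    have "J \<subseteq> {0..<b}" using le J(3) False by (force simp: order_le_less)
    moreover have "{0..<b} \<subseteq> J" using lt by auto
    ultimately have "J = {0..<b}" by blast
    with \<open>b > 0\<close> show ?thesis using that(3) by blast
  qed
qed

text \<open>Both bounded shapes of \<open>J\<close> contradict maximality: a closed interval is
  prolonged by Peano's theorem, a half-open one is closed up by the limit in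
  \<open>K\<close>.\<close>

lemma maximal_forward_solution_global:
  assumes U: "open U" and G: "continuous_on U G" and K: "compact K" "K \<subseteq> U"
    and max: "maximal_forward_solution U G J x" and xK: "\<And>t. t \<in> J \<Longrightarrow> x t \<in> K"
  shows "J = {0..}"
proof -
  have sol: "forward_solution U G J x"
    and mx: "\<And>J' y. forward_solution U G J' y \<Longrightarrow> J \<subseteq> J' \<Longrightarrow> (\<forall>t\<in>J. y t = x t) \<Longrightarrow> J' = J"
    using max unfolding maximal_forward_solution_def by blast+
  have J: "is_interval J" "0 \<in> J" "J \<subseteq> {0..}" using sol by (auto simp: forward_solution_def)
  from J show ?thesis
  proof (cases rule: nonneg_interval_cases)
    case (2 b)
    obtain h y where h: "h > 0" and y: "forward_solution U G {0..b + h} y"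
      and yx: "\<And>t. t \<in> {0..b} \<Longrightarrow> y t = x t"
      using forward_solution_extend[OF U G] sol 2 by metis
    have "{0..b + h} = J" by (rule mx[OF y]) (use 2 h yx in auto)
    then show ?thesis using 2 h by auto
  next
    case (3 b)
    obtain y where y: "forward_solution U G {0..b} y" and yx: "\<And>t. t \<in> {0..<b} \<Longrightarrow> y t = x t"
      using forward_solution_closed_extend[OF G K, of b x] sol 3 xK by metis
    have "{0..b} = J" by (rule mx[OF y]) (use 3 yx in auto)
    then have "b \<in> J" using 3 by auto
    then show ?thesis using 3 by auto
  qed
qed

text \<open>The mean value theorem for \<open>V\<close> along the solution. The case
  \<open>\<alpha> = 0\<close> gives monotonicity, a positive \<alpha> forces a linear
  decrease.\<close>

lemma forward_solution_decrease:
  fixes V :: "'a::euclidean_space \<Rightarrow> real"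
  assumes sol: "forward_solution U G J x"
    and DV: "\<And>y. y \<in> U \<Longrightarrow> (V has_derivative DV y) (at y)"
    and st: "s \<in> J" "t \<in> J" "s \<le> t"
    and \<alpha>: "\<And>r. r \<in> {s..t} \<Longrightarrow> DV (x r) (G (x r)) \<le> - \<alpha>"
  shows "V (x t) \<le> V (x s) - \<alpha> * (t - s)"
proof (cases "s = t")
  case False
  then have lt: "s < t" using st by simp
  have J: "is_interval J" using sol by (simp add: forward_solution_def)
  have sub: "{s..t} \<subseteq> J" using mem_is_interval_1_I[OF J st(1,2)] by auto
  have d: "((\<lambda>r. V (x r)) has_derivative (\<lambda>h. DV (x r) (h *\<^sub>R G (x r)))) (at r within {s..t})"
    if r: "r \<in> {s..t}" for r
  proof -
    have "x r \<in> U" "(x has_vector_derivative G (x r)) (at r within J)"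
      using sol sub r unfolding forward_solution_def by blast+
    then have "(x has_derivative (\<lambda>h. h *\<^sub>R G (x r))) (at r within {s..t})"
      using has_vector_derivative_within_subset[OF _ sub] by (auto simp: has_vector_derivative_def)
    from has_derivative_in_compose2[OF has_derivative_at_withinI[OF DV] _ r this, of U]
    show ?thesis using sol sub by (auto simp: forward_solution_def)
  qed
  obtain r where r: "r \<in> {s<..<t}" "V (x t) - V (x s) = DV (x r) ((t - s) *\<^sub>R G (x r))"
    using mvt_simple[OF lt d] by auto
  have "r \<in> J" using sub r by auto
  then have "x r \<in> U" using sol by (auto simp: forward_solution_def)
  then have "linear (DV (x r))" using DV has_derivative_linear by blast
  then have "V (x t) - V (x s) = (t - s) * DV (x r) (G (x r))"
    using r by (simp add: linear_cmul)
  also have "\<dots> \<le> (t - s) * - \<alpha>" using \<alpha>[of r] r lt by (intro mult_left_mono) auto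
  finally show ?thesis by (simp add: mult.commute)
qed auto

text \<open>Properness makes small values of \<open>V\<close> force nearness to 0: what lies outside
  \<open>W\<close> in the sub-level set of level 1 is compact, so \<open>V\<close> has a positive
  minimum there.\<close>

lemma Lyapunov_sublevel_subset:
  fixes V :: "'a::euclidean_space \<Rightarrow> real"
  assumes cV: "continuous_on U V" and pos: "\<And>x. x \<in> U - {0} \<Longrightarrow> V x > 0"
    and cpt: "\<And>c. c \<ge> 0 \<Longrightarrow> compact {x\<in>U. V x \<le> c}"
    and W: "open W" "0 \<in> W"
  obtains c where "c > 0" "\<And>x. x \<in> U \<Longrightarrow> V x < c \<Longrightarrow> x \<in> W"
proof (cases "{x\<in>U. V x \<le> 1} - W = {}")
  case True
  then show thesis using that[of 1] by force
next
  case False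
  have "compact ({x\<in>U. V x \<le> 1} - W)" using cpt[of 1] W by (simp add: compact_diff)
  then obtain p where p: "p \<in> {x\<in>U. V x \<le> 1} - W" "\<And>x. x \<in> {x\<in>U. V x \<le> 1} - W \<Longrightarrow> V p \<le> V x"
    using continuous_attains_inf[OF _ False continuous_on_subset[OF cV]] by fast
  have "V p > 0" using p(1) pos W by auto
  moreover have "x \<in> W" if "x \<in> U" "V x < min 1 (V p)" for x
    using p(2)[of x] that by fastforce
  ultimately show thesis using that[of "min 1 (V p)"] by auto
qed

text \<open>Sub-level sets are forward invariant, whence stability, and compact, whence global
  existence. If \<open>V\<close> stayed above some \<open>c > 0\<close> along a solution, the
  solution would remain in a compact set avoiding 0, where \<open>DV y (G y)\<close> has a negative
  maximum, and \<open>V\<close> would eventually become negative.\<close>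

lemma Lyapunov_GAS_zero:
  fixes V :: "'a::euclidean_space \<Rightarrow> real"
  assumes U: "open U" "0 \<in> U" and G: "continuous_on U G" "G 0 = 0"
    and DV: "\<And>y. y \<in> U \<Longrightarrow> (V has_derivative DV y) (at y)"
    and cDV: "continuous_on U (\<lambda>y. DV y (G y))"
    and V0: "V 0 = 0" and pos: "\<And>x. x \<in> U - {0} \<Longrightarrow> V x > 0"
    and neg: "\<And>x. x \<in> U - {0} \<Longrightarrow> DV x (G x) < 0"
    and cpt: "\<And>c. c \<ge> 0 \<Longrightarrow> compact {x\<in>U. V x \<le> c}"
  shows "GAS_zero U G"
proof -
  have cV: "continuous_on U V"
    using DV has_derivative_continuous continuous_at_imp_continuous_on by blast
  have nn: "V x \<ge> 0" if "x \<in> U" for x using V0 pos[of x] that by (cases "x = 0") (auto simp: less_imp_le)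
  have le0: "DV x (G x) \<le> 0" if "x \<in> U" for x
  proof (cases "x = 0")
    case True
    then show ?thesis using has_derivative_linear[OF DV[OF U(2)]] G(2) by (simp add: linear_0)
  qed (use neg[of x] that in auto)
  have mono: "V (x t) \<le> V (x s)" if "forward_solution U G J x" "s \<in> J" "t \<in> J" "s \<le> t" for J x s t
  proof -
    have "{s..t} \<subseteq> J"
      using mem_is_interval_1_I[of J s t] that unfolding forward_solution_def by auto
    then have "DV (x r) (G (x r)) \<le> - 0" if "r \<in> {s..t}" for r
      using le0[of "x r"] that \<open>forward_solution U G J x\<close> by (auto simp: forward_solution_def)
    from forward_solution_decrease[OF that(1) DV that(2-4) this] show ?thesis by simp
  qed
  have stab: "\<exists>U\<delta>. open U\<delta> \<and> 0 \<in> U\<delta> \<and> U\<delta> \<subseteq> W \<and>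
     (\<forall>J x. forward_solution U G J x \<and> x 0 \<in> U\<delta> \<longrightarrow> (\<forall>t\<in>J. x t \<in> W))"
    if W: "open W" "0 \<in> W" "W \<subseteq> U" for W
  proof -
    obtain c where c: "c > 0" "\<And>x. x \<in> U \<Longrightarrow> V x < c \<Longrightarrow> x \<in> W"
      using Lyapunov_sublevel_subset[OF cV pos cpt W(1,2)] by metis
    define D where "D = {x\<in>U. V x < c}"
    have D: "D = U \<inter> V -` {..<c}" by (auto simp: D_def)
    have "open D" unfolding D
      by (rule continuous_open_preimage[OF cV U(1)]) auto
    moreover have "0 \<in> D" using U V0 c by (simp add: D_def)
    moreover have "D \<subseteq> W" using c by (auto simp: D_def)
    moreover have "x t \<in> W" if "forward_solution U G J x" "x 0 \<in> D" "t \<in> J" for J x t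
    proof -
      have "V (x t) \<le> V (x 0)" "x t \<in> U"
        using mono[OF that(1), of 0 t] that by (auto simp: forward_solution_def)
      then show ?thesis using c(2) that by (auto simp: D_def)
    qed
    ultimately show ?thesis by blast
  qed
  have conv: "J = {0..} \<and> (x \<longlongrightarrow> 0) at_top" if max: "maximal_forward_solution U G J x" for J x
  proof
    have sol: "forward_solution U G J x" using max by (simp add: maximal_forward_solution_def)
    then have xU: "x t \<in> U" if "t \<in> J" for t using that by (auto simp: forward_solution_def)
    have J0: "0 \<in> J" "J \<subseteq> {0..}" using sol by (auto simp: forward_solution_def)
    define K where "K = {y\<in>U. V y \<le> V (x 0)}"
    have K: "compact K" "K \<subseteq> U" using cpt nn[OF xU[OF J0(1)]] by (auto simp: K_def)
    have xK: "x t \<in> K" if "t \<in> J" for t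
      using mono[OF sol J0(1) that] J0 that xU by (auto simp: K_def)
    show J: "J = {0..}" by (rule maximal_forward_solution_global[OF U(1) G(1) K max xK])
    have small: "\<exists>T\<ge>0. V (x T) < c" if c: "c > 0" for c
    proof (rule ccontr)
      assume "\<not> ?thesis"
      then have ge: "c \<le> V (x t)" if "t \<ge> 0" for t using that by force
      define A where "A = {y\<in>K. c \<le> V y}"
      have "A = K \<inter> V -` {c..}" by (auto simp: A_def)
      then have A: "compact A"
        using continuous_closed_preimage[OF continuous_on_subset[OF cV K(2)] compact_imp_closed[OF K(1)], of "{c..}"]
          compact_Int_closed[OF K(1)] by (metis closed_atLeast inf.idem inf_assoc)
      have xA: "x t \<in> A" if "t \<ge> 0" for t using that xK J ge by (auto simp: A_def)
      then have ne: "A \<noteq> {}" by blast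
      have AU: "A \<subseteq> U - {0}" using c V0 K by (auto simp: A_def)
      obtain p where p: "p \<in> A" "\<And>y. y \<in> A \<Longrightarrow> DV y (G y) \<le> DV p (G p)"
        using continuous_attains_sup[OF A ne continuous_on_subset[OF cDV]] AU by blast
      define \<alpha> where "\<alpha> = - DV p (G p)"
      have \<alpha>: "\<alpha> > 0" using neg p AU by (auto simp: \<alpha>_def)
      \<comment> \<open>At this time the linear bound \<open>V (x 0) - \<alpha> * T\<close> equals
        \<open>- \<alpha>\<close>.\<close>
      define T where "T = V (x 0) / \<alpha> + 1"
      have V00: "0 \<le> V (x 0)" using nn xU J0 by blast
      have T: "T \<ge> 0" using V00 \<alpha> by (simp add: T_def)
      have "V (x T) \<le> V (x 0) - \<alpha> * (T - 0)"
        by (rule forward_solution_decrease[OF sol DV]) (use p(2) xA T J in \<open>auto simp: \<alpha>_def\<close>)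
      also have "\<dots> < 0" using \<alpha> by (simp add: T_def algebra_simps)
      finally show False using nn[OF xU] J T by force
    qed
    show "(x \<longlongrightarrow> 0) at_top"
      unfolding tendsto_def
    proof (intro allI impI)
      fix W :: "'a set" assume W: "open W" "0 \<in> W"
      obtain c where c: "c > 0" "\<And>x. x \<in> U \<Longrightarrow> V x < c \<Longrightarrow> x \<in> W"
        using Lyapunov_sublevel_subset[OF cV pos cpt W] by metis
      obtain T where T: "T \<ge> 0" "V (x T) < c" using small[OF c(1)] by blast
      have "x t \<in> W" if "t \<ge> T" for t
        using mono[OF sol, of T t] T that J xU c(2)[of "x t"] by auto
      then show "\<forall>\<^sub>F t in at_top. x t \<in> W" by (auto simp: eventually_at_top_linorder)
    qed
  qed
  show ?thesis
    unfolding GAS_zero_def using G stab conv by blast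
qed

subsection \<open>The spray of a Riemannian metric\<close>

lemma lipschitz_on_mult_compact:
  fixes f h :: "'b::metric_space \<Rightarrow> real"
  assumes S: "compact S" and f: "\<exists>L. L-lipschitz_on S f" and h: "\<exists>L. L-lipschitz_on S h"
  shows "\<exists>L. L-lipschitz_on S (\<lambda>x. f x * h x)"
proof -
  obtain L M where L: "L-lipschitz_on S f" and M: "M-lipschitz_on S h" using f h by blast
  have "bounded (f ` S)" "bounded (h ` S)"
    using L M by (auto intro!: compact_imp_bounded compact_continuous_image S lipschitz_on_continuous_on)
  then obtain A B where A: "\<And>x. x \<in> S \<Longrightarrow> \<bar>f x\<bar> \<le> A" and B: "\<And>x. x \<in> S \<Longrightarrow> \<bar>h x\<bar> \<le> B"
    unfolding bounded_iff by auto
  have "(\<bar>A\<bar> * M + \<bar>B\<bar> * L)-lipschitz_on S (\<lambda>x. f x * h x)"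
  proof (rule lipschitz_onI)
    fix x y assume xy: "x \<in> S" "y \<in> S"
    have "dist (f x * h x) (f y * h y) = \<bar>f x * (h x - h y) + (f x - f y) * h y\<bar>"
      by (simp add: dist_real_def algebra_simps)
    also have "\<dots> \<le> \<bar>f x\<bar> * \<bar>h x - h y\<bar> + \<bar>f x - f y\<bar> * \<bar>h y\<bar>"
      by (metis abs_mult abs_triangle_ineq)
    also have "\<dots> \<le> \<bar>A\<bar> * (M * dist x y) + (L * dist x y) * \<bar>B\<bar>"
      using lipschitz_onD[OF L xy] lipschitz_onD[OF M xy] A[OF xy(1)] B[OF xy(2)]
      by (intro add_mono mult_mono) (auto simp: dist_real_def intro: order_trans[OF _ abs_ge_self])
    finally show "dist (f x * h x) (f y * h y) \<le> (\<bar>A\<bar> * M + \<bar>B\<bar> * L) * dist x y"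
      by (simp add: algebra_simps)
  qed (use lipschitz_on_nonneg[OF L] lipschitz_on_nonneg[OF M] in auto)
  then show ?thesis by blast
qed

text \<open>The constants stay existential in this group of rules, so that they chain mechanically
  over the coordinate expansion of \<open>force\<close>.\<close>

lemma lipschitz_on_diff_ex:
  fixes f h :: "'b::metric_space \<Rightarrow> 'c::real_normed_vector"
  assumes "\<exists>L. L-lipschitz_on S f" "\<exists>L. L-lipschitz_on S h"
  shows "\<exists>L. L-lipschitz_on S (\<lambda>x. f x - h x)"
  using assms lipschitz_on_diff by blast

lemma lipschitz_on_sum_ex:
  fixes f :: "'i \<Rightarrow> 'b::metric_space \<Rightarrow> 'c::real_normed_vector"
  assumes "\<And>i. i \<in> I \<Longrightarrow> \<exists>L. L-lipschitz_on S (f i)"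
  shows "\<exists>L. L-lipschitz_on S (\<lambda>x. \<Sum>i\<in>I. f i x)"
  using assms
proof (induction I rule: infinite_finite_induct)
  case (insert i I)
  then have "\<exists>L. L-lipschitz_on S (f i)" "\<exists>L. L-lipschitz_on S (\<lambda>x. \<Sum>i\<in>I. f i x)" by auto
  then show ?case using lipschitz_on_add insert(1,2) by (metis (no_types, lifting) lipschitz_on_cong sum.insert)
qed (auto intro: lipschitz_on_constant)

lemma norm_le_sum_Basis:
  fixes A :: "'a::euclidean_space \<Rightarrow> 'b::real_normed_vector"
  assumes "linear A"
  shows "norm (A v) \<le> (\<Sum>b\<in>Basis. norm (A b)) * norm v"
proof -
  have "A v = A (\<Sum>b\<in>Basis. (v \<bullet> b) *\<^sub>R b)" by (simp add: euclidean_representation)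
  also have "\<dots> = (\<Sum>b\<in>Basis. (v \<bullet> b) *\<^sub>R A b)"
    using assms by (simp add: linear_sum linear_cmul)
  also have "norm \<dots> \<le> (\<Sum>b\<in>Basis. norm (A b) * norm v)"
    by (rule sum_norm_le) (simp add: mult.commute[of _ "norm v"] mult_right_mono Basis_le_norm)
  finally show ?thesis by (simp add: sum_distrib_right)
qed

text \<open>\<open>Ck_on\<close> gives continuity of the derivative only for each fixed direction.
  The sum of the norms over the basis is continuous in the base point and dominates the operator
  norm, which is therefore bounded on \<open>S\<close>; convexity admits the mean value
  inequality.\<close>

lemma C1_lipschitz_on_compact_convex:
  fixes f :: "'a::euclidean_space \<Rightarrow> 'b::real_normed_vector"
  assumes f: "Ck_on (Suc 0) f UNIV" and S: "compact S" "convex S"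
  shows "\<exists>L. L-lipschitz_on S f"
proof -
  have df: "(f has_derivative frechet_derivative f (at x)) (at x)" for x
    using f by (simp add: frechet_derivative_works)
  have cont: "continuous_on S (\<lambda>x. \<Sum>b\<in>Basis. norm (frechet_derivative f (at x) b))"
    using f by (auto intro!: continuous_intros intro: continuous_on_subset)
  then obtain B where B: "\<And>x. x \<in> S \<Longrightarrow> norm (\<Sum>b\<in>Basis. norm (frechet_derivative f (at x) b)) \<le> B"
    using compact_imp_bounded[OF compact_continuous_image[OF cont S(1)]] unfolding bounded_iff by blast
  have "\<bar>B\<bar>-lipschitz_on S f"
  proof (rule lipschitz_onI)
    fix x y assume xy: "x \<in> S" "y \<in> S"
    have "norm (f x - f y) \<le> \<bar>B\<bar> * norm (x - y)"
    proof (rule differentiable_bound[OF S(2) has_derivative_at_withinI[OF df] _ xy])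
      fix z assume z: "z \<in> S"
      show "onorm (frechet_derivative f (at z)) \<le> \<bar>B\<bar>"
      proof (rule onorm_le)
        fix v
        have "norm (frechet_derivative f (at z) v) \<le> (\<Sum>b\<in>Basis. norm (frechet_derivative f (at z) b)) * norm v"
          by (rule norm_le_sum_Basis[OF has_derivative_linear[OF df]])
        also have "\<dots> \<le> \<bar>B\<bar> * norm v" using B[OF z] by (intro mult_right_mono) auto
        finally show "norm (frechet_derivative f (at z) v) \<le> \<bar>B\<bar> * norm v" .
      qed
    qed
    then show "dist (f x) (f y) \<le> \<bar>B\<bar> * dist x y" by (simp add: dist_norm)
  qed auto
  then show ?thesis by blast
qed

lemma bilinear_Basis_expand:
  fixes h :: "'a::euclidean_space \<Rightarrow> 'a \<Rightarrow> real"
  assumes "bilinear h"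
  shows "h u v = (\<Sum>i\<in>Basis. \<Sum>j\<in>Basis. (u \<bullet> i) * (v \<bullet> j) * h i j)"
proof -
  have "h u v = h (\<Sum>i\<in>Basis. (u \<bullet> i) *\<^sub>R i) (\<Sum>j\<in>Basis. (v \<bullet> j) *\<^sub>R j)"
    by (simp add: euclidean_representation)
  also have "\<dots> = (\<Sum>(i,j)\<in>Basis \<times> Basis. h ((u \<bullet> i) *\<^sub>R i) ((v \<bullet> j) *\<^sub>R j))"
    using assms by (rule bilinear_sum)
  also have "\<dots> = (\<Sum>i\<in>Basis. \<Sum>j\<in>Basis. (u \<bullet> i) * (v \<bullet> j) * h i j)"
    using assms by (simp add: sum.cartesian_product bilinear_lmul bilinear_rmul mult_ac)
  finally show ?thesis .
qed

section \<open>The metric and its first derivatives in coordinates\<close>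

locale riemannian =
  fixes g :: "'a::euclidean_space \<Rightarrow> 'a \<Rightarrow> 'a \<Rightarrow> real"
  assumes metric: "riemannian_metric g"
begin

lemma bilinear_g: "bilinear (g x)"
  and g_sym: "g x u v = g x v u"
  and g_pos: "u \<noteq> 0 \<Longrightarrow> g x u u > 0"
  and g_smooth: "Cinfinity_on (\<lambda>x. g x u v) UNIV"
  using metric unfolding riemannian_metric_def by blast+

lemmas g_linear = bilinear_ladd[OF bilinear_g] bilinear_radd[OF bilinear_g]
  bilinear_lsub[OF bilinear_g] bilinear_rsub[OF bilinear_g]
  bilinear_lmul[OF bilinear_g] bilinear_rmul[OF bilinear_g]
  bilinear_lzero[OF bilinear_g] bilinear_rzero[OF bilinear_g]

lemmas g_expand = bilinear_Basis_expand[OF bilinear_g]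

text \<open>The argument after the base point is the direction of differentiation; the last two are
  the slots of the metric.\<close>

definition dg :: "'a \<Rightarrow> 'a \<Rightarrow> 'a \<Rightarrow> 'a \<Rightarrow> real" where
  "dg x w u v = frechet_derivative (\<lambda>y. g y u v) (at x) w"

lemma g_has_derivative: "((\<lambda>y. g y u v) has_derivative (\<lambda>w. dg x w u v)) (at x)"
proof -
  have "Ck_on (Suc 0) (\<lambda>y. g y u v) UNIV" using g_smooth unfolding Cinfinity_on_def by blast
  then have "(\<lambda>y. g y u v) differentiable (at x)" by simp
  then show ?thesis unfolding dg_def by (simp add: frechet_derivative_works)
qed

lemma C1_g: "Ck_on (Suc 0) (\<lambda>y. g y u v) UNIV"
  using g_smooth unfolding Cinfinity_on_def by blast

lemma C1_dg: "Ck_on (Suc 0) (\<lambda>y. dg y w u v) UNIV"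
proof -
  have "Ck_on (Suc (Suc 0)) (\<lambda>y. g y u v) UNIV" using g_smooth unfolding Cinfinity_on_def by blast
  then show ?thesis unfolding dg_def by simp
qed

lemma dg_linear: "linear (\<lambda>w. dg x w u v)"
  using g_has_derivative has_derivative_linear by blast

text \<open>By uniqueness of derivatives, linearity and symmetry in the slots are inherited from the
  metric.\<close>

lemma dg_bilinear: "bilinear (dg x w)"
proof -
  have add1: "dg x w (u + u') v = dg x w u v + dg x w u' v" for u u' v
    using has_derivative_unique[OF g_has_derivative[of "u + u'" v x]]
      has_derivative_add[OF g_has_derivative[of u v x] g_has_derivative[of u' v x]]
    by (auto simp: g_linear dest: fun_cong)
  have sc1: "dg x w (c *\<^sub>R u) v = c *\<^sub>R dg x w u v" for c u v
    using has_derivative_unique[OF g_has_derivative[of "c *\<^sub>R u" v x]]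
      has_derivative_scaleR_right[OF g_has_derivative[of u v x], of c]
    by (auto simp: g_linear dest: fun_cong)
  have sym: "dg x w u v = dg x w v u" for u v
    unfolding dg_def by (subst g_sym) simp
  show ?thesis
    unfolding bilinear_def
    by (auto intro!: linearI simp: add1 sc1 sym[of _ "_ + _"] sym[of _ "_ *\<^sub>R _"])
      (auto simp: sym)
qed

lemma dg_expand:
  "dg x w u v = (\<Sum>k\<in>Basis. \<Sum>i\<in>Basis. \<Sum>j\<in>Basis. (w \<bullet> k) * (u \<bullet> i) * (v \<bullet> j) * dg x k i j)"
proof -
  have "dg x w u v = dg x (\<Sum>k\<in>Basis. (w \<bullet> k) *\<^sub>R k) u v" by (simp add: euclidean_representation)
  also have "\<dots> = (\<Sum>k\<in>Basis. (w \<bullet> k) * dg x k u v)"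
    by (simp add: linear_sum[OF dg_linear] linear_cmul[OF dg_linear])
  also have "\<dots> = (\<Sum>k\<in>Basis. \<Sum>i\<in>Basis. \<Sum>j\<in>Basis. (w \<bullet> k) * (u \<bullet> i) * (v \<bullet> j) * dg x k i j)"
    by (subst bilinear_Basis_expand[OF dg_bilinear]) (simp add: sum_distrib_left mult_ac)
  finally show ?thesis .
qed

text \<open>Smoothness of the metric is stated for fixed tangent vectors; joint continuity comes
  from the finitely many coefficient functions \<open>g x i j\<close>.\<close>

lemma continuous_on_g [continuous_intros]:
  assumes "continuous_on S p" "continuous_on S q" "continuous_on S r"
  shows "continuous_on S (\<lambda>a. g (p a) (q a) (r a))"
proof -
  have "continuous_on S (\<lambda>a. g (p a) i j)" for i j
    by (rule continuous_on_compose2[OF _ assms(1), of UNIV])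
       (use g_smooth[of i j] in \<open>auto simp: Cinfinity_on_def dest: spec[of _ 0]\<close>)
  then show ?thesis by (subst g_expand) (intro continuous_intros assms)
qed

lemma continuous_on_dg [continuous_intros]:
  assumes "continuous_on S p" "continuous_on S h" "continuous_on S q" "continuous_on S r"
  shows "continuous_on S (\<lambda>a. dg (p a) (h a) (q a) (r a))"
proof -
  have "continuous_on S (\<lambda>a. dg (p a) k i j)" for k i j
    by (rule continuous_on_compose2[OF _ assms(1), of UNIV])
       (use C1_g[of i j] in \<open>auto simp: dg_def\<close>)
  then show ?thesis by (subst dg_expand) (intro continuous_intros assms)
qed

text \<open>The product rule in all three slots, computed in coordinates. The first variation, the
  geodesic equation and the conservation of speed all rest on it.\<close>

lemma g_has_real_derivative:
  assumes "(p has_vector_derivative p') (at t within S)"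
    "(u has_vector_derivative u') (at t within S)" "(v has_vector_derivative v') (at t within S)"
  shows "((\<lambda>t. g (p t) (u t) (v t)) has_real_derivative
    dg (p t) p' (u t) (v t) + g (p t) u' (v t) + g (p t) (u t) v') (at t within S)"
proof -
  have inner: "((\<lambda>t. u t \<bullet> i) has_real_derivative u' \<bullet> i) (at t within S)"
    if "(u has_vector_derivative u') (at t within S)" for u :: "real \<Rightarrow> 'a" and u' i
    using has_derivative_inner_left[OF that[unfolded has_vector_derivative_def], of i]
    by (simp add: has_field_derivative_def mult.commute[of _ "u' \<bullet> i"])
  have gp: "((\<lambda>t. g (p t) i j) has_real_derivative dg (p t) p' i j) (at t within S)" for i j
  proof -
    have "((\<lambda>t. g (p t) i j) has_derivative (\<lambda>h. dg (p t) (h *\<^sub>R p') i j)) (at t within S)"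
      using has_derivative_compose[OF assms(1)[unfolded has_vector_derivative_def] g_has_derivative] .
    moreover have "(\<lambda>h. dg (p t) (h *\<^sub>R p') i j) = (*) (dg (p t) p' i j)"
      by (simp add: fun_eq_iff linear_cmul[OF dg_linear])
    ultimately show ?thesis by (simp add: has_field_derivative_def)
  qed
  have "((\<lambda>t. \<Sum>i\<in>Basis. \<Sum>j\<in>Basis. (u t \<bullet> i) * (v t \<bullet> j) * g (p t) i j) has_real_derivative
    (\<Sum>i\<in>Basis. \<Sum>j\<in>Basis. (u t \<bullet> i) * (v t \<bullet> j) * dg (p t) p' i j + (u' \<bullet> i) * (v t \<bullet> j) * g (p t) i j
        + (u t \<bullet> i) * (v' \<bullet> j) * g (p t) i j)) (at t within S)"
    by (auto intro!: derivative_eq_intros inner[OF assms(2)] inner[OF assms(3)] gp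
        sum.cong simp: algebra_simps)
  also have "(\<lambda>t. \<Sum>i\<in>Basis. \<Sum>j\<in>Basis. (u t \<bullet> i) * (v t \<bullet> j) * g (p t) i j) = (\<lambda>t. g (p t) (u t) (v t))"
    by (rule ext) (rule g_expand[symmetric])
  also have "(\<Sum>i\<in>Basis. \<Sum>j\<in>Basis. (u t \<bullet> i) * (v t \<bullet> j) * dg (p t) p' i j + (u' \<bullet> i) * (v t \<bullet> j) * g (p t) i j
        + (u t \<bullet> i) * (v' \<bullet> j) * g (p t) i j) = dg (p t) p' (u t) (v t) + g (p t) u' (v t) + g (p t) (u t) v'"
    by (simp only: sum.distrib g_expand[of _ u' "v t", symmetric] g_expand[of _ "u t" v', symmetric]
        bilinear_Basis_expand[OF dg_bilinear, symmetric])
  finally show ?thesis .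
qed

text \<open>The constant is the minimum of the metric over unit vectors at points of the ball;
  homogeneity does the rest. It converts bounds in terms of \<open>g\<close> into norm bounds,
  uniformly in the base point.\<close>

lemma g_elliptic:
  obtains \<kappa> where "\<kappa> > 0" "\<And>x u. x \<in> cball 0 R \<Longrightarrow> \<kappa> * (norm u)\<^sup>2 \<le> g x u u"
proof (cases "cball 0 R = ({} :: 'a set)")
  case True then show thesis using that[of 1] by auto
next
  case False
  define S where "S = cball (0::'a) R \<times> sphere (0::'a) 1"
  have "sphere (0::'a) 1 \<noteq> {}" by simp
  with False have ne: "S \<noteq> {}" by (simp add: S_def)
  have "compact S" by (simp add: S_def compact_Times)
  moreover have "continuous_on S (\<lambda>a. g (fst a) (snd a) (snd a))" by (intro continuous_intros)
  ultimately obtain a where a: "a \<in> S" "\<And>b. b \<in> S \<Longrightarrow> g (fst a) (snd a) (snd a) \<le> g (fst b) (snd b) (snd b)"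
    using continuous_attains_inf[OF _ ne] by blast
  define \<kappa> where "\<kappa> = g (fst a) (snd a) (snd a)"
  have "\<kappa> > 0" unfolding \<kappa>_def by (rule g_pos) (use a(1) in \<open>auto simp: S_def\<close>)
  moreover have "\<kappa> * (norm u)\<^sup>2 \<le> g x u u" if x: "x \<in> cball 0 R" for x u
  proof (cases "u = 0")
    case False
    have "\<kappa> \<le> g x (u /\<^sub>R norm u) (u /\<^sub>R norm u)"
      unfolding \<kappa>_def using a(2)[of "(x, u /\<^sub>R norm u)"] x False by (simp add: S_def)
    also have "\<dots> = g x u u / (norm u)\<^sup>2"
      using False by (simp add: g_linear power2_eq_square field_simps)
    finally show ?thesis using False by (simp add: field_simps)
  qed (simp add: g_linear)
  ultimately show thesis using that by blast
qed

text \<open>Riesz representation for \<open>g x\<close>: the associated linear map is injective by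
  positivity, hence surjective in finite dimension.\<close>

lemma g_representation:
  assumes "linear \<phi>"
  shows "\<exists>w. \<forall>z. g x w z = \<phi> z"
proof -
  define A where "A w = (\<Sum>i\<in>Basis. g x w i *\<^sub>R i)" for w
  have Ai: "A w \<bullet> z = g x w z" for w z
  proof -
    have "g x w z = g x w (\<Sum>i\<in>Basis. (z \<bullet> i) *\<^sub>R i)" by (simp add: euclidean_representation)
    also have "\<dots> = (\<Sum>i\<in>Basis. (z \<bullet> i) * g x w i)"
      using bilinear_g[of x] by (simp add: bilinear_def linear_sum linear_cmul)
    finally show ?thesis by (simp add: A_def inner_commute[of _ z] inner_sum_right mult.commute)
  qed
  have "linear A"
    by (rule linearI) (simp_all add: A_def g_linear sum.distrib scaleR_add_left scaleR_sum_right)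
  moreover have "inj A"
    unfolding linear_injective_0[OF \<open>linear A\<close>] using Ai g_pos by (metis inner_zero_left less_irrefl)
  ultimately have "surj A" by (rule linear_injective_imp_surjective) (rule refl)
  then obtain w where w: "A w = (\<Sum>i\<in>Basis. \<phi> i *\<^sub>R i)" by (metis surjD)
  have "g x w z = \<phi> z" for z
  proof -
    have "g x w z = (\<Sum>i\<in>Basis. (z \<bullet> i) * \<phi> i)"
      unfolding Ai[symmetric] w by (simp add: inner_commute[of _ z] inner_sum_right mult.commute)
    also have "\<dots> = \<phi> (\<Sum>i\<in>Basis. (z \<bullet> i) *\<^sub>R i)" using assms by (simp add: linear_sum linear_cmul)
    finally show ?thesis by (simp add: euclidean_representation)
  qed
  then show ?thesis by blast
qed

lemma g_eqI:
  assumes "\<And>z. g x u z = g x v z"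
  shows "u = v"
proof (rule ccontr)
  assume "u \<noteq> v"
  then have "g x (u - v) (u - v) > 0" by (intro g_pos) auto
  then show False using assms[of "u - v"] by (simp add: g_linear)
qed

text \<open>Along an extremal the momentum \<open>g c c' z\<close>, for fixed \<open>z\<close>, has
  derivative \<open>1/2 * dg c z c' c'\<close>. By the product rule this derivative is also
  \<open>dg c c' c' z + g c c'' z\<close>, so \<open>force\<close> is the covector that represents
  \<open>c''\<close>.\<close>

definition force :: "'a \<Rightarrow> 'a \<Rightarrow> 'a \<Rightarrow> real" where
  "force x v z = 1/2 * dg x z v v - dg x v v z"

lemma linear_force: "linear (force x v)"
proof -
  have "linear (\<lambda>z. dg x v v z)" using dg_bilinear by (simp add: bilinear_def)
  then show ?thesis
    using dg_linear[of x v v] unfolding force_def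
    by (intro linear_compose_sub) (auto simp: linear_iff algebra_simps)
qed

text \<open>The Euler-Lagrange equation of the energy is \<open>\<gamma>'' = spray \<gamma> \<gamma>'\<close>.\<close>

definition spray :: "'a \<Rightarrow> 'a \<Rightarrow> 'a" where
  "spray x v = (SOME w. \<forall>z. g x w z = force x v z)"

lemma g_spray: "g x (spray x v) z = force x v z"
  unfolding spray_def using someI_ex[OF g_representation[OF linear_force]] by blast

text \<open>The force is quadratic in the velocity. This homogeneity allows affine reparametrisation
  of geodesics, and it makes the spray a small perturbation at low speed.\<close>

lemma spray_scaleR: "spray x (c *\<^sub>R v) = c\<^sup>2 *\<^sub>R spray x v"
proof (rule g_eqI)
  fix z
  have "force x (c *\<^sub>R v) z = c\<^sup>2 * force x v z"
    using linear_cmul[OF dg_linear[of x]] dg_bilinear[of x]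
    by (simp add: force_def bilinear_lmul bilinear_rmul power2_eq_square algebra_simps)
  then show "g x (spray x (c *\<^sub>R v)) z = g x (c\<^sup>2 *\<^sub>R spray x v) z"
    by (simp add: g_spray g_linear)
qed

lemma spray_zero [simp]: "spray x 0 = 0"
  using spray_scaleR[of x 0 0] by simp

text \<open>For fixed \<open>z\<close> the force is a polynomial in the velocity whose coefficients
  are C1 functions of the base point.\<close>

lemma force_lipschitz:
  assumes "compact C" "convex C" "compact D"
  shows "\<exists>L. L-lipschitz_on (C \<times> D) (\<lambda>a. force (fst a) (snd a) z)"
proof -
  let ?S = "C \<times> D"
  have S: "compact ?S" using assms by (simp add: compact_Times)
  have fst: "1-lipschitz_on ?S fst" by (rule lipschitz_onI) (auto simp: dist_fst_le)
  have c: "\<exists>L. L-lipschitz_on ?S (\<lambda>a. dg (fst a) k i j)" for k i j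
  proof -
    obtain L where L: "L-lipschitz_on C (\<lambda>x. dg x k i j)"
      using C1_lipschitz_on_compact_convex[OF C1_dg assms(1,2)] by blast
    have "L-lipschitz_on (fst ` ?S) (\<lambda>x. dg x k i j)" by (rule lipschitz_on_subset[OF L]) auto
    from lipschitz_on_compose2[OF fst this] show ?thesis by blast
  qed
  have s: "\<exists>L. L-lipschitz_on ?S (\<lambda>a. snd a \<bullet> i)" for i
  proof -
    have "(norm i)-lipschitz_on ?S (\<lambda>a. snd a \<bullet> i)"
    proof (rule lipschitz_onI)
      fix a b :: "'a \<times> 'a"
      have "dist (snd a \<bullet> i) (snd b \<bullet> i) = \<bar>(snd a - snd b) \<bullet> i\<bar>"
        by (simp add: dist_real_def inner_diff_left)
      also have "\<dots> \<le> dist (snd a) (snd b) * norm i"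
        by (simp add: Cauchy_Schwarz_ineq2 dist_norm)
      also have "\<dots> \<le> norm i * dist a b" by (simp add: mult.commute dist_snd_le mult_left_mono)
      finally show "dist (snd a \<bullet> i) (snd b \<bullet> i) \<le> norm i * dist a b" .
    qed simp
    then show ?thesis by blast
  qed
  have k: "\<exists>L. L-lipschitz_on ?S (\<lambda>a. c)" for c :: real using lipschitz_on_constant by blast
  show ?thesis
    unfolding force_def
    by (subst (1 2) dg_expand)
       (intro lipschitz_on_diff_ex lipschitz_on_mult_compact S k c s lipschitz_on_sum_ex)
qed

lemma g_lipschitz:
  assumes "compact C" "convex C"
  obtains L where "L \<ge> 0"
    "\<And>x y u v. x \<in> C \<Longrightarrow> y \<in> C \<Longrightarrow> \<bar>g x u v - g y u v\<bar> \<le> L * dist x y * norm u * norm v"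
proof -
  have "\<exists>L. L-lipschitz_on C (\<lambda>x. g x i j)" for i j
    by (rule C1_lipschitz_on_compact_convex[OF C1_g assms])
  then obtain l where l: "\<And>i j. (l i j)-lipschitz_on C (\<lambda>x. g x i j)" by metis
  define L where "L = (\<Sum>i\<in>Basis. \<Sum>j\<in>Basis. l i j)"
  have "\<bar>g x u v - g y u v\<bar> \<le> L * dist x y * norm u * norm v" if xy: "x \<in> C" "y \<in> C" for x y u v
  proof -
    have "\<bar>g x u v - g y u v\<bar> = \<bar>\<Sum>i\<in>Basis. \<Sum>j\<in>Basis. (u \<bullet> i) * (v \<bullet> j) * (g x i j - g y i j)\<bar>"
      by (subst (1 2) g_expand) (simp add: sum_subtractf algebra_simps)
    also have "\<dots> \<le> (\<Sum>i\<in>Basis. \<Sum>j\<in>Basis. \<bar>(u \<bullet> i) * (v \<bullet> j) * (g x i j - g y i j)\<bar>)"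
      by (intro order_trans[OF sum_abs] sum_mono sum_abs)
    also have "\<dots> \<le> (\<Sum>i\<in>Basis. \<Sum>j\<in>Basis. norm u * norm v * (l i j * dist x y))"
    proof (intro sum_mono)
      fix i j :: 'a assume ij: "i \<in> Basis" "j \<in> Basis"
      have "\<bar>g x i j - g y i j\<bar> \<le> l i j * dist x y"
        using lipschitz_onD[OF l xy] by (simp add: dist_real_def)
      then show "\<bar>(u \<bullet> i) * (v \<bullet> j) * (g x i j - g y i j)\<bar> \<le> norm u * norm v * (l i j * dist x y)"
        unfolding abs_mult by (intro mult_mono Basis_le_norm ij) auto
    qed
    also have "\<dots> = L * dist x y * norm u * norm v"
      by (simp add: L_def sum_distrib_left sum_distrib_right mult_ac)
    finally show ?thesis .
  qed
  moreover have "L \<ge> 0" unfolding L_def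
    by (intro sum_nonneg lipschitz_on_nonneg[OF l])
  ultimately show thesis using that by blast
qed

text \<open>Linearity in \<open>z\<close> reduces the estimate to basis vectors; this makes one
  constant work for all \<open>z\<close>, so that \<open>z\<close> may later be the difference of
  two sprays.\<close>

lemma force_lipschitz_norm:
  assumes "compact C" "convex C" "compact D"
  obtains L where "L \<ge> 0"
    "\<And>x y u v z. x \<in> C \<Longrightarrow> y \<in> C \<Longrightarrow> u \<in> D \<Longrightarrow> v \<in> D \<Longrightarrow>
       \<bar>force x u z - force y v z\<bar> \<le> L * dist (x, u) (y, v) * norm z"
proof -
  obtain l where l: "\<And>z. (l z)-lipschitz_on (C \<times> D) (\<lambda>a. force (fst a) (snd a) z)"
    using force_lipschitz[OF assms] by metis
  define L where "L = (\<Sum>k\<in>Basis. l k)"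
  have "\<bar>force x u z - force y v z\<bar> \<le> L * dist (x, u) (y, v) * norm z"
    if "x \<in> C" "y \<in> C" "u \<in> D" "v \<in> D" for x y u v z
  proof -
    have "linear (\<lambda>z. force x u z - force y v z)"
      by (intro linear_compose_sub linear_force)
    then have "norm (force x u z - force y v z) \<le> (\<Sum>k\<in>Basis. norm (force x u k - force y v k)) * norm z"
      by (rule norm_le_sum_Basis)
    also have "\<dots> \<le> (\<Sum>k\<in>Basis. l k * dist (x, u) (y, v)) * norm z"
      using lipschitz_onD[OF l, of "(x, u)" "(y, v)"] that
      by (intro mult_right_mono sum_mono) (auto simp: dist_norm)
    finally show ?thesis by (simp add: L_def sum_distrib_right)
  qed
  moreover have "L \<ge> 0" unfolding L_def by (intro sum_nonneg lipschitz_on_nonneg[OF l])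
  ultimately show thesis using that by blast
qed

text \<open>The spray is known only implicitly through \<open>g_spray\<close>. The difference
  \<open>d\<close> of two values is therefore tested against itself: ellipticity bounds
  \<open>g x d d\<close> below by the square of \<open>norm d\<close>, the Lipschitz bounds give an
  upper bound linear in \<open>norm d\<close>, and one factor cancels.\<close>

lemma spray_lipschitz:
  obtains M where "M-lipschitz_on (cball 0 R \<times> cball 0 R) (\<lambda>a. spray (fst a) (snd a))"
proof -
  let ?B = "cball (0::'a) R"
  obtain \<kappa> where \<kappa>: "\<kappa> > 0" "\<And>x u. x \<in> ?B \<Longrightarrow> \<kappa> * (norm u)\<^sup>2 \<le> g x u u"
    using g_elliptic by metis
  obtain L where L: "L \<ge> 0"
    "\<And>x y u v. x \<in> ?B \<Longrightarrow> y \<in> ?B \<Longrightarrow> \<bar>g x u v - g y u v\<bar> \<le> L * dist x y * norm u * norm v"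
    using g_lipschitz[of ?B] by auto
  obtain N where N: "N \<ge> 0" "\<And>x y u v z. x \<in> ?B \<Longrightarrow> y \<in> ?B \<Longrightarrow> u \<in> ?B \<Longrightarrow> v \<in> ?B \<Longrightarrow>
       \<bar>force x u z - force y v z\<bar> \<le> N * dist (x, u) (y, v) * norm z"
    using force_lipschitz_norm[of ?B ?B] by auto
  have cancel: "norm d \<le> c / \<kappa>" if "\<kappa> * (norm d)\<^sup>2 \<le> c * norm d" "c \<ge> 0" for c and d :: 'a
  proof (cases "d = 0")
    case False
    then have "\<kappa> * norm d \<le> c" using that by (simp add: power2_eq_square)
    then show ?thesis using \<kappa>(1) by (simp add: field_simps)
  qed (use that \<kappa> in simp)
  \<comment> \<open>A bound for the spray on the ball, obtained by comparison with velocity 0, where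
    the force vanishes.\<close>
  define Q where "Q = N * \<bar>R\<bar> / \<kappa>"
  have Q: "norm (spray x v) \<le> Q" if "x \<in> ?B" "v \<in> ?B" for x v
  proof -
    let ?w = "spray x v"
    have f0: "force x 0 z = 0" for z using g_spray[of x 0 z] by (simp add: g_linear)
    have "0 \<in> ?B" using that(1) order_trans[OF norm_ge_zero] by auto
    have "\<kappa> * (norm ?w)\<^sup>2 \<le> g x ?w ?w" using \<kappa>(2) that by blast
    also have "\<dots> = force x v ?w - force x 0 ?w" by (simp add: g_spray f0)
    also have "\<dots> \<le> N * dist (x, v) (x, 0) * norm ?w"
      using N(2)[OF that(1) that(1) that(2) \<open>0 \<in> ?B\<close>, of ?w] by simp
    also have "\<dots> \<le> N * \<bar>R\<bar> * norm ?w"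
      using that N(1) by (intro mult_right_mono mult_left_mono) (auto simp: dist_Pair_Pair)
    finally show ?thesis unfolding Q_def using N(1) by (intro cancel) auto
  qed
  define M where "M = (N + L * \<bar>Q\<bar>) / \<kappa>"
  have "M-lipschitz_on (?B \<times> ?B) (\<lambda>a. spray (fst a) (snd a))"
  proof (rule lipschitz_onI)
    fix a b assume ab: "a \<in> ?B \<times> ?B" "b \<in> ?B \<times> ?B"
    obtain x u y v where a: "a = (x, u)" and b: "b = (y, v)" by (cases a, cases b)
    have B: "x \<in> ?B" "y \<in> ?B" "u \<in> ?B" "v \<in> ?B" using ab by (auto simp: a b)
    let ?d = "spray x u - spray y v"
    have "dist x y \<le> dist a b" using dist_fst_le[of a b] by (simp add: a b)
    have "\<kappa> * (norm ?d)\<^sup>2 \<le> g x ?d ?d" using \<kappa>(2) B by blast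
    \<comment> \<open>The metric at \<open>x\<close> is exchanged for the one at \<open>y\<close> in
      the second spray, so that \<open>g_spray\<close> applies to both.\<close>
    also have "\<dots> = (force x u ?d - force y v ?d) + (g y (spray y v) ?d - g x (spray y v) ?d)"
      by (simp add: g_spray[symmetric] g_linear)
    also have "\<dots> \<le> N * dist a b * norm ?d + L * dist y x * norm (spray y v) * norm ?d"
      using N(2)[OF B, of ?d] L(2)[OF B(2,1), of "spray y v" ?d] unfolding a b by linarith
    also have "L * dist y x * norm (spray y v) \<le> L * dist a b * \<bar>Q\<bar>"
      using Q[OF B(2,4)] \<open>dist x y \<le> dist a b\<close> L(1)
      by (intro mult_mono) (auto simp: dist_commute)
    finally have "\<kappa> * (norm ?d)\<^sup>2 \<le> (N * dist a b + L * dist a b * \<bar>Q\<bar>) * norm ?d"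
      by (simp add: algebra_simps mult_right_mono)
    then have "norm ?d \<le> (N * dist a b + L * dist a b * \<bar>Q\<bar>) / \<kappa>"
      using N(1) L(1) by (intro cancel) auto
    also have "\<dots> = M * dist a b" by (simp add: M_def field_simps)
    finally show "dist (spray (fst a) (snd a)) (spray (fst b) (snd b)) \<le> M * dist a b"
      by (simp add: a b dist_norm)
  qed (use N(1) L(1) \<kappa>(1) in \<open>simp add: M_def\<close>)
  then show thesis by (rule that)
qed

lemma continuous_on_spray [continuous_intros]:
  assumes "continuous_on S p" "continuous_on S q"
  shows "continuous_on S (\<lambda>a. spray (p a) (q a))"
proof -
  have "continuous_on UNIV (\<lambda>a. spray (fst a) (snd a))"
  proof (rule continuous_at_imp_continuous_on, rule ballI)
    fix a :: "'a \<times> 'a"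
    define R where "R = norm (fst a) + norm (snd a) + 1"
    obtain M where "M-lipschitz_on (cball 0 R \<times> cball 0 R) (\<lambda>a. spray (fst a) (snd a))"
      by (rule spray_lipschitz)
    then have "continuous_on (ball 0 R \<times> ball 0 R) (\<lambda>a. spray (fst a) (snd a))"
      by (intro continuous_on_subset[OF lipschitz_on_continuous_on]) auto
    moreover have "a \<in> ball 0 R \<times> ball 0 R"
      by (simp add: R_def mem_Times_iff add_nonneg_pos)
    ultimately show "isCont (\<lambda>a. spray (fst a) (snd a)) a"
      using continuous_on_eq_continuous_at[OF open_Times[OF open_ball open_ball]] by blast
  qed
  from continuous_on_compose2[OF this continuous_on_Pair[OF assms]] show ?thesis by simp
qed

end

subsection \<open>Geodesics as solutions of the geodesic equation\<close>

lemma velocity_eq: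
  assumes "(c has_vector_derivative v) (at t within {0..1})" "t \<in> {0..1}"
  shows "velocity c t = v"
  unfolding velocity_def using vector_derivative_within_closed_interval[OF _ assms(2,1)] by simp

lemma C1_curve_has_velocity:
  "C1_curve c \<Longrightarrow> t \<in> {0..1} \<Longrightarrow> (c has_vector_derivative velocity c t) (at t within {0..1})"
  unfolding C1_curve_def velocity_def by (simp add: vector_derivative_works)

lemma C1_curve_continuous: "C1_curve c \<Longrightarrow> continuous_on {0..1} c"
  using C1_curve_has_velocity has_vector_derivative_continuous continuous_on_eq_continuous_within by blast

lemma C1_curveI:
  assumes "\<And>t. t \<in> {0..1} \<Longrightarrow> (c has_vector_derivative v t) (at t within {0..1})" "continuous_on {0..1} v"
  shows "C1_curve c"
proof -
  have "continuous_on {0..1} (velocity c)"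
    using assms(2) by (rule continuous_on_eq) (simp add: velocity_eq[OF assms(1)])
  moreover have "c differentiable (at t within {0..1})" if "t \<in> {0..1}" for t
    using assms(1)[OF that] by (auto simp: has_vector_derivative_def differentiable_def)
  ultimately show ?thesis by (simp add: C1_curve_def)
qed

text \<open>The test curve has derivative \<open>D = P - R - m\<close>, where \<open>R\<close> is
  the primitive of \<open>Q\<close> and \<open>m\<close> the mean of \<open>P - R\<close>, so that
  it vanishes at both ends. After integration by parts the hypothesis reads that the integral of
  \<open>D t \<bullet> D t\<close> is 0, whence \<open>P = R + m\<close>.\<close>

lemma du_Bois_Reymond:
  fixes P Q :: "real \<Rightarrow> 'a::euclidean_space"
  assumes P: "continuous_on {0..1} P" and Q: "continuous_on {0..1} Q"
    and zero: "\<And>\<eta>. C1_curve \<eta> \<Longrightarrow> \<eta> 0 = 0 \<Longrightarrow> \<eta> 1 = 0 \<Longrightarrow>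
      integral {0..1} (\<lambda>t. Q t \<bullet> \<eta> t + P t \<bullet> velocity \<eta> t) = 0"
    and t: "t \<in> {0..1}"
  shows "(P has_vector_derivative Q t) (at t within {0..1})"
proof -
  define R where "R t = integral {0..t} Q" for t
  have R: "(R has_vector_derivative Q t) (at t within {0..1})" if "t \<in> {0..1}" for t
    unfolding R_def by (rule integral_has_vector_derivative[OF Q that])
  have cR: "continuous_on {0..1} R"
    using R has_vector_derivative_continuous continuous_on_eq_continuous_within by blast
  define m where "m = integral {0..1} (\<lambda>t. P t - R t)"
  define D where "D t = P t - R t - m" for t
  have cD: "continuous_on {0..1} D" unfolding D_def by (intro continuous_intros P cR)
  define \<eta> where "\<eta> t = integral {0..t} D" for t
  have d\<eta>: "(\<eta> has_vector_derivative D t) (at t within {0..1})" if "t \<in> {0..1}" for t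
    unfolding \<eta>_def by (rule integral_has_vector_derivative[OF cD that])
  have c\<eta>: "continuous_on {0..1} \<eta>"
    using d\<eta> has_vector_derivative_continuous continuous_on_eq_continuous_within by blast
  have v\<eta>: "velocity \<eta> t = D t" if "t \<in> {0..1}" for t by (rule velocity_eq[OF d\<eta> that]) (rule that)
  have \<eta>0: "\<eta> 0 = 0" by (simp add: \<eta>_def)
  have PR: "(\<lambda>t. P t - R t) integrable_on {0..1}"
    by (intro integrable_continuous_real continuous_intros P cR)
  have \<eta>1: "\<eta> 1 = 0"
    unfolding \<eta>_def D_def by (subst integral_diff[OF PR]) (auto simp: m_def)
  have "0 = integral {0..1} (\<lambda>t. Q t \<bullet> \<eta> t + P t \<bullet> velocity \<eta> t)"
    using zero[OF C1_curveI[OF d\<eta> cD] \<eta>0 \<eta>1] by simp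
  also have "\<dots> = integral {0..1} (\<lambda>t. (Q t \<bullet> \<eta> t + R t \<bullet> D t) + (m \<bullet> D t + D t \<bullet> D t))"
    by (rule Henstock_Kurzweil_Integration.integral_cong) (simp add: v\<eta> D_def algebra_simps)
  also have "\<dots> = integral {0..1} (\<lambda>t. Q t \<bullet> \<eta> t + R t \<bullet> D t)
      + (integral {0..1} (\<lambda>t. m \<bullet> D t) + integral {0..1} (\<lambda>t. D t \<bullet> D t))"
    by (subst integral_add integral_add,
        auto intro!: integrable_continuous_real continuous_intros Q cR cD c\<eta>)+
  also have "integral {0..1} (\<lambda>t. Q t \<bullet> \<eta> t + R t \<bullet> D t) = R 1 \<bullet> \<eta> 1 - R 0 \<bullet> \<eta> 0"
  proof (rule integral_unique, rule fundamental_theorem_of_calculus)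
    fix t :: real assume "t \<in> {0..1}"
    from bounded_bilinear.has_vector_derivative[OF bounded_bilinear_inner R[OF this] d\<eta>[OF this]]
    show "((\<lambda>t. R t \<bullet> \<eta> t) has_vector_derivative Q t \<bullet> \<eta> t + R t \<bullet> D t) (at t within {0..1})"
      by (simp add: add.commute)
  qed simp
  also have "integral {0..1} (\<lambda>t. m \<bullet> D t) = m \<bullet> \<eta> 1"
    unfolding \<eta>_def using integral_linear[OF integrable_continuous_real[OF cD] bounded_linear_inner_right[of m]]
    by (simp add: o_def)
  finally have "integral {0..1} (\<lambda>t. D t \<bullet> D t) = 0" by (simp add: \<eta>0 \<eta>1)
  then have "\<forall>t\<in>{0..1}. D t \<bullet> D t = 0"
    by (subst (asm) integral_eq_0_iff) (auto intro!: continuous_intros cD)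
  then have "D t = 0" if "t \<in> {0..1}" for t using that by (simp only: inner_eq_zero_iff)
  then have PR: "P t = R t + m" if "t \<in> {0..1}" for t using that by (simp add: D_def algebra_simps)
  have "((\<lambda>t. R t + m) has_vector_derivative Q t) (at t within {0..1})"
    using has_vector_derivative_add[OF R[OF t] has_vector_derivative_const[of m]] by simp
  then show ?thesis by (rule has_vector_derivative_transform[OF t, rotated]) (rule PR)
qed

section \<open>The Euler-Lagrange correspondence\<close>

context riemannian
begin

text \<open>The geodesic equation as a first-order system. The velocity is a separate argument
  because limits and fixed points produce it along with the curve.\<close>

definition spray_curve :: "(real \<Rightarrow> 'a) \<Rightarrow> (real \<Rightarrow> 'a) \<Rightarrow> bool" where
  "spray_curve c w \<longleftrightarrow> (\<forall>t\<in>{0..1}. (c has_vector_derivative w t) (at t within {0..1}) \<and>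
     (w has_vector_derivative spray (c t) (w t)) (at t within {0..1}))"

lemma spray_curveD:
  assumes "spray_curve c w"
  shows "t \<in> {0..1} \<Longrightarrow> (c has_vector_derivative w t) (at t within {0..1})"
    "t \<in> {0..1} \<Longrightarrow> (w has_vector_derivative spray (c t) (w t)) (at t within {0..1})"
    "continuous_on {0..1} c" "continuous_on {0..1} w" "C1_curve c"
    "t \<in> {0..1} \<Longrightarrow> velocity c t = w t"
proof -
  show 1: "(c has_vector_derivative w t) (at t within {0..1})"
    and 2: "(w has_vector_derivative spray (c t) (w t)) (at t within {0..1})" if "t \<in> {0..1}" for t
    using assms that unfolding spray_curve_def by auto
  show "continuous_on {0..1} c"
    using 1 has_vector_derivative_continuous continuous_on_eq_continuous_within by blast
  show w: "continuous_on {0..1} w"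
    using 2 has_vector_derivative_continuous continuous_on_eq_continuous_within by blast
  show "C1_curve c" using C1_curveI[OF 1 w] .
  show "t \<in> {0..1} \<Longrightarrow> velocity c t = w t" using velocity_eq[OF 1] by blast
qed

text \<open>Differentiation under the integral sign, legitimate as the differentiated integrand is
  jointly continuous for C1 curves. The two terms with the velocity of \<eta> coincide by symmetry
  and absorb the factor 1/2.\<close>

lemma first_variation:
  assumes c: "C1_curve c" and \<eta>: "C1_curve \<eta>"
  shows "((\<lambda>s. energy g (\<lambda>t. c t + s *\<^sub>R \<eta> t)) has_real_derivative
     integral {0..1} (\<lambda>t. 1/2 * dg (c t) (\<eta> t) (velocity c t) (velocity c t)
        + g (c t) (velocity c t) (velocity \<eta> t))) (at 0)"
proof -
  let ?c' = "velocity c" and ?\<eta>' = "velocity \<eta>"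
  have cont: "continuous_on {0..1} c" "continuous_on {0..1} \<eta>"
    "continuous_on {0..1} ?c'" "continuous_on {0..1} ?\<eta>'"
    using C1_curve_continuous c \<eta> unfolding C1_curve_def by auto
  define f where "f s t = g (c t + s *\<^sub>R \<eta> t) (?c' t + s *\<^sub>R ?\<eta>' t) (?c' t + s *\<^sub>R ?\<eta>' t)" for s t
  define f' where "f' s t = dg (c t + s *\<^sub>R \<eta> t) (\<eta> t) (?c' t + s *\<^sub>R ?\<eta>' t) (?c' t + s *\<^sub>R ?\<eta>' t)
      + g (c t + s *\<^sub>R \<eta> t) (?\<eta>' t) (?c' t + s *\<^sub>R ?\<eta>' t)
      + g (c t + s *\<^sub>R \<eta> t) (?c' t + s *\<^sub>R ?\<eta>' t) (?\<eta>' t)" for s t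
  have E: "energy g (\<lambda>t. c t + s *\<^sub>R \<eta> t) = 1/2 * integral (cbox 0 1) (f s)" for s
  proof -
    have "velocity (\<lambda>t. c t + s *\<^sub>R \<eta> t) t = ?c' t + s *\<^sub>R ?\<eta>' t" if "t \<in> {0..1}" for t
    proof (rule velocity_eq[OF _ that])
      have "((\<lambda>t. s *\<^sub>R \<eta> t) has_vector_derivative s *\<^sub>R ?\<eta>' t) (at t within {0..1})"
        using has_vector_derivative_scaleR[OF DERIV_const C1_curve_has_velocity[OF \<eta> that]] by simp
      then show "((\<lambda>t. c t + s *\<^sub>R \<eta> t) has_vector_derivative ?c' t + s *\<^sub>R ?\<eta>' t) (at t within {0..1})"
        by (intro has_vector_derivative_add C1_curve_has_velocity[OF c that])
    qed
    then show ?thesis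
      unfolding energy_def f_def by (auto intro!: Henstock_Kurzweil_Integration.integral_cong)
  qed
  have "((\<lambda>s. integral (cbox 0 1) (f s)) has_field_derivative integral (cbox 0 1) (f' 0)) (at 0 within UNIV)"
  proof (rule leibniz_rule_field_derivative)
    fix s t :: real assume "t \<in> cbox 0 1"
    have lin: "((\<lambda>s. a + s *\<^sub>R b) has_vector_derivative b) (at s)" for a b :: 'a and s :: real
      by (auto intro!: derivative_eq_intros)
    show "((\<lambda>s. f s t) has_field_derivative f' s t) (at s within UNIV)"
      unfolding f_def f'_def by (rule g_has_real_derivative[OF lin lin lin])
  next
    fix s :: real
    show "f s integrable_on cbox 0 1"
      unfolding f_def by (intro integrable_continuous continuous_intros) (simp_all add: cont)
  next
    have c2: "continuous_on (UNIV \<times> cbox 0 1) (\<lambda>a. h (snd a))"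
      if "continuous_on {0..1} h" for h :: "real \<Rightarrow> 'a"
      by (rule continuous_on_compose2[OF that continuous_on_snd[OF continuous_on_id]]) auto
    have "continuous_on (UNIV \<times> cbox 0 1) (\<lambda>a. f' (fst a) (snd a))"
      unfolding f'_def by (intro continuous_intros c2 cont)
    then show "continuous_on (UNIV \<times> cbox 0 1) (\<lambda>(s, t). f' s t)" by (simp add: case_prod_unfold)
  qed auto
  from DERIV_cmult[OF this, of "1/2"]
  have "((\<lambda>s. energy g (\<lambda>t. c t + s *\<^sub>R \<eta> t)) has_real_derivative 1/2 * integral (cbox 0 1) (f' 0)) (at 0)"
    by (simp add: E)
  also have "1/2 * integral (cbox 0 1) (f' 0) = integral (cbox 0 1) (\<lambda>t. 1/2 * f' 0 t)"
    by (rule integral_mult_right[symmetric])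
  also have "\<dots> = integral {0..1} (\<lambda>t. 1/2 * dg (c t) (\<eta> t) (?c' t) (?c' t) + g (c t) (?c' t) (?\<eta>' t))"
    unfolding cbox_interval
    by (rule Henstock_Kurzweil_Integration.integral_cong) (simp add: f'_def g_sym[of _ "?\<eta>' _"])
  finally show ?thesis .
qed

text \<open>Along a solution the integrand of the first variation is the derivative of
  \<open>g (c t) (w t) (\<eta> t)\<close>, which vanishes at both ends.\<close>

lemma spray_curve_imp_geodesic:
  assumes "spray_curve c w"
  shows "geodesic g c"
  unfolding geodesic_def
proof (intro conjI allI impI)
  note c = spray_curveD[OF assms]
  show "C1_curve c" by (rule c)
  fix \<eta> :: "real \<Rightarrow> 'a" assume "C1_curve \<eta> \<and> \<eta> 0 = 0 \<and> \<eta> 1 = 0"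
  then have \<eta>: "C1_curve \<eta>" "\<eta> 0 = 0" "\<eta> 1 = 0" by auto
  have "((\<lambda>t. 1/2 * dg (c t) (\<eta> t) (velocity c t) (velocity c t) + g (c t) (velocity c t) (velocity \<eta> t))
      has_integral g (c 1) (w 1) (\<eta> 1) - g (c 0) (w 0) (\<eta> 0)) {0..1}"
  proof (rule fundamental_theorem_of_calculus)
    fix t :: real assume t: "t \<in> {0..1}"
    have "((\<lambda>t. g (c t) (w t) (\<eta> t)) has_real_derivative
       dg (c t) (w t) (w t) (\<eta> t) + g (c t) (spray (c t) (w t)) (\<eta> t) + g (c t) (w t) (velocity \<eta> t))
       (at t within {0..1})"
      by (rule g_has_real_derivative[OF c(1)[OF t] c(2)[OF t] C1_curve_has_velocity[OF \<eta>(1) t]])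
    then show "((\<lambda>t. g (c t) (w t) (\<eta> t)) has_vector_derivative
       1/2 * dg (c t) (\<eta> t) (velocity c t) (velocity c t) + g (c t) (velocity c t) (velocity \<eta> t))
       (at t within {0..1})"
      by (simp add: has_real_derivative_iff_has_vector_derivative g_spray force_def c(6)[OF t])
  qed simp
  then have "integral {0..1} (\<lambda>t. 1/2 * dg (c t) (\<eta> t) (velocity c t) (velocity c t)
      + g (c t) (velocity c t) (velocity \<eta> t)) = 0"
    by (simp add: integral_unique \<eta> g_linear)
  then show "((\<lambda>s. energy g (\<lambda>t. c t + s *\<^sub>R \<eta> t)) has_real_derivative 0) (at 0)"
    using first_variation[OF c(5) \<eta>(1)] by simp
qed

text \<open>For a C1 extremal only the momentum is known to be differentiable, so the product rule
  cannot be applied to \<open>w\<close>. Instead \<open>w\<close> is recovered from the momentum: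
  the error of its difference quotient, paired with any fixed vector under \<open>g (c s)\<close>,
  tends to 0, and ellipticity, uniform along the curve, makes the error itself tend to 0.\<close>

lemma momentum_derivative_imp_spray:
  assumes c: "\<And>t. t \<in> {0..1} \<Longrightarrow> (c has_vector_derivative w t) (at t within {0..1})"
    and P: "\<And>t z. t \<in> {0..1} \<Longrightarrow> P t \<bullet> z = g (c t) (w t) z"
    and dP: "(P has_vector_derivative Q) (at t within {0..1})"
    and Q: "\<And>z. Q \<bullet> z = 1/2 * dg (c t) z (w t) (w t)"
    and t: "t \<in> {0..1}"
  shows "(w has_vector_derivative spray (c t) (w t)) (at t within {0..1})"
proof -
  let ?F = "at t within {0..1}"
  define p where "p = spray (c t) (w t)"
  define d where "d s = (1 / (s - t)) *\<^sub>R (w s - w t) - p" for s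
  have cc: "continuous_on {0..1} c"
    using c has_vector_derivative_continuous continuous_on_eq_continuous_within by blast
  have "bounded (c ` {0..1})" by (intro compact_imp_bounded compact_continuous_image cc) simp
  then obtain R where R: "\<And>s. s \<in> {0..1} \<Longrightarrow> norm (c s) \<le> R" unfolding bounded_iff by blast
  obtain \<kappa> where \<kappa>: "\<kappa> > 0" "\<And>x u. x \<in> cball 0 R \<Longrightarrow> \<kappa> * (norm u)\<^sup>2 \<le> g x u u"
    using g_elliptic by metis
  have ev: "\<forall>\<^sub>F s in ?F. s \<in> {0..1} \<and> s \<noteq> t" by (simp add: eventually_at_filter)
  \<comment> \<open>Subtracting \<open>g (c s) (w t) z\<close> from the momentum leaves
    \<open>g (c s) (w s - w t) z\<close>, the numerator of the difference quotient, and both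
    subtracted terms are differentiable.\<close>
  have lim: "((\<lambda>s. g (c s) (d s) z) \<longlongrightarrow> 0) ?F" for z
  proof -
    have dP': "((\<lambda>s. P s \<bullet> z) has_real_derivative Q \<bullet> z) ?F"
      using has_derivative_inner_left[OF dP[unfolded has_vector_derivative_def], of z]
      by (simp add: has_field_derivative_def mult.commute[of _ "Q \<bullet> z"])
    have "((\<lambda>s. g (c s) (w t) z) has_real_derivative dg (c t) (w t) (w t) z + g (c t) 0 z + g (c t) (w t) 0) ?F"
      by (rule g_has_real_derivative[OF c[OF t] has_vector_derivative_const has_vector_derivative_const])
    then have "((\<lambda>s. P s \<bullet> z - g (c s) (w t) z) has_real_derivative Q \<bullet> z - dg (c t) (w t) (w t) z) ?F"
      by (intro DERIV_diff dP') (simp add: g_linear)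
    then have "((\<lambda>s. ((P s \<bullet> z - g (c s) (w t) z) - (P t \<bullet> z - g (c t) (w t) z)) / (s - t))
        \<longlongrightarrow> Q \<bullet> z - dg (c t) (w t) (w t) z) ?F"
      by (simp add: has_field_derivative_iff)
    moreover have "((\<lambda>s. g (c s) p z) \<longlongrightarrow> g (c t) p z) ?F"
    proof -
      have "continuous_on {0..1} (\<lambda>s. g (c s) p z)" by (intro continuous_intros cc)
      then show ?thesis using t by (simp add: continuous_on_def)
    qed
    ultimately have "((\<lambda>s. ((P s \<bullet> z - g (c s) (w t) z) - (P t \<bullet> z - g (c t) (w t) z)) / (s - t) - g (c s) p z)
        \<longlongrightarrow> (Q \<bullet> z - dg (c t) (w t) (w t) z) - g (c t) p z) ?F"
      by (rule tendsto_diff)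
    moreover have "(Q \<bullet> z - dg (c t) (w t) (w t) z) - g (c t) p z = 0"
      by (simp add: p_def g_spray force_def Q)
    moreover have "\<forall>\<^sub>F s in ?F. ((P s \<bullet> z - g (c s) (w t) z) - (P t \<bullet> z - g (c t) (w t) z)) / (s - t) - g (c s) p z
        = g (c s) (d s) z"
      using ev by eventually_elim (simp add: P P[OF t] d_def g_linear)
    ultimately show ?thesis using tendsto_cong by force
  qed
  have "((\<lambda>s. (\<Sum>i\<in>Basis. \<bar>g (c s) (d s) i\<bar>) / \<kappa>) \<longlongrightarrow> (\<Sum>i\<in>(Basis::'a set). \<bar>0\<bar>) / \<kappa>) ?F"
    by (intro tendsto_intros lim) (use \<kappa> in auto)
  then have lim2: "((\<lambda>s. (\<Sum>i\<in>Basis. \<bar>g (c s) (d s) i\<bar>) / \<kappa>) \<longlongrightarrow> 0) ?F" by simp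
  have d0: "(d \<longlongrightarrow> 0) ?F"
  proof (rule Lim_null_comparison[OF _ lim2])
    show "\<forall>\<^sub>F s in ?F. norm (d s) \<le> (\<Sum>i\<in>Basis. \<bar>g (c s) (d s) i\<bar>) / \<kappa>"
      using ev
    proof eventually_elim
      case (elim s)
      \<comment> \<open>Pairing with \<open>d s\<close> itself is reduced to the basis vectors, for
        which the limit is known.\<close>
      have "\<kappa> * (norm (d s))\<^sup>2 \<le> norm (g (c s) (d s) (d s))"
        using \<kappa>(2)[of "c s" "d s"] R elim by (auto intro: order_trans[OF _ abs_ge_self])
      also have "\<dots> \<le> (\<Sum>i\<in>Basis. norm (g (c s) (d s) i)) * norm (d s)"
        by (rule norm_le_sum_Basis) (use bilinear_g in \<open>auto simp: bilinear_def\<close>)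
      finally have *: "\<kappa> * (norm (d s))\<^sup>2 \<le> (\<Sum>i\<in>Basis. \<bar>g (c s) (d s) i\<bar>) * norm (d s)" by simp
      show ?case
      proof (cases "d s = 0")
        case False
        then have "\<kappa> * norm (d s) \<le> (\<Sum>i\<in>Basis. \<bar>g (c s) (d s) i\<bar>)"
          using * by (simp add: power2_eq_square)
        then show ?thesis using \<kappa>(1) by (simp add: field_simps)
      qed (use \<kappa> in \<open>simp add: sum_nonneg\<close>)
    qed
  qed
  have "((\<lambda>s. (1 / norm (s - t)) *\<^sub>R (w s - (w t + (s - t) *\<^sub>R p))) \<longlongrightarrow> 0) ?F"
  proof (rule Lim_null_comparison[OF _ tendsto_norm_zero[OF d0]])
    show "\<forall>\<^sub>F s in ?F. norm ((1 / norm (s - t)) *\<^sub>R (w s - (w t + (s - t) *\<^sub>R p))) \<le> norm (d s)"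
      using ev
    proof eventually_elim
      case (elim s)
      then have "w s - (w t + (s - t) *\<^sub>R p) = (s - t) *\<^sub>R d s" by (simp add: d_def algebra_simps)
      then show ?case using elim by simp
    qed
  qed
  then show ?thesis
    unfolding has_vector_derivative_def has_derivative_within p_def[symmetric]
    by (simp add: bounded_linear_scaleR_left)
qed

lemma geodesic_imp_spray_curve:
  assumes geo: "geodesic g c"
  shows "spray_curve c (velocity c)"
proof -
  let ?w = "velocity c"
  have c: "C1_curve c" using geo by (simp add: geodesic_def)
  have cont: "continuous_on {0..1} c" "continuous_on {0..1} ?w"
    using C1_curve_continuous c unfolding C1_curve_def by auto
  \<comment> \<open>\<open>P\<close> and \<open>Q\<close> represent the two covectors in the first
    variation by Euclidean vectors, the form required by \<open>du_Bois_Reymond\<close>.\<close>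
  define P where "P t = (\<Sum>i\<in>Basis. g (c t) (?w t) i *\<^sub>R i)" for t
  define Q where "Q t = (\<Sum>i\<in>Basis. (1/2 * dg (c t) i (?w t) (?w t)) *\<^sub>R i)" for t
  have repr: "(\<Sum>i\<in>Basis. \<phi> i *\<^sub>R i) \<bullet> z = \<phi> z" if "linear \<phi>" for \<phi> :: "'a \<Rightarrow> real" and z
  proof -
    have "(\<Sum>i\<in>Basis. \<phi> i *\<^sub>R i) \<bullet> z = \<phi> (\<Sum>i\<in>Basis. (z \<bullet> i) *\<^sub>R i)"
      by (simp add: linear_sum[OF that] linear_cmul[OF that] inner_commute[of _ z] inner_sum_right mult.commute)
    then show ?thesis by (simp add: euclidean_representation)
  qed
  have P: "P t \<bullet> z = g (c t) (?w t) z" for t z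
    unfolding P_def by (rule repr) (use bilinear_g in \<open>auto simp: bilinear_def\<close>)
  have Q: "Q t \<bullet> z = 1/2 * dg (c t) z (?w t) (?w t)" for t z
    unfolding Q_def by (rule repr) (use linear_compose_scale_right[OF dg_linear, of "1/2"] in simp)
  have dP: "(P has_vector_derivative Q t) (at t within {0..1})" if t: "t \<in> {0..1}" for t
  proof (rule du_Bois_Reymond[OF _ _ _ t])
    show "continuous_on {0..1} P" "continuous_on {0..1} Q"
      unfolding P_def Q_def by (intro continuous_intros cont)+
    fix \<eta> :: "real \<Rightarrow> 'a" assume \<eta>: "C1_curve \<eta>" "\<eta> 0 = 0" "\<eta> 1 = 0"
    then have "((\<lambda>s. energy g (\<lambda>t. c t + s *\<^sub>R \<eta> t)) has_real_derivative 0) (at 0)"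
      using geo unfolding geodesic_def by blast
    from DERIV_unique[OF first_variation[OF c \<eta>(1)] this]
    show "integral {0..1} (\<lambda>t. Q t \<bullet> \<eta> t + P t \<bullet> velocity \<eta> t) = 0" by (simp add: P Q)
  qed
  show ?thesis
    unfolding spray_curve_def
  proof (intro ballI conjI)
    fix t :: real assume t: "t \<in> {0..1}"
    show "(c has_vector_derivative ?w t) (at t within {0..1})" by (rule C1_curve_has_velocity[OF c t])
    show "(?w has_vector_derivative spray (c t) (?w t)) (at t within {0..1})"
      by (rule momentum_derivative_imp_spray[OF C1_curve_has_velocity[OF c] P dP[OF t] Q t])
  qed
qed

text \<open>The derivative is \<open>dg c w w w + 2 * force c w w\<close>, and the force on
  \<open>w\<close> itself is \<open>- 1/2 * dg c w w w\<close>.\<close>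

lemma spray_curve_constant_speed:
  assumes c: "spray_curve c w" and t: "t \<in> {0..1}"
  shows "g (c t) (w t) (w t) = g (c 0) (w 0) (w 0)"
proof -
  have "((\<lambda>t. g (c t) (w t) (w t)) has_derivative (\<lambda>h. 0)) (at t within {0..1})" if t: "t \<in> {0..1}" for t
    using g_has_real_derivative[OF spray_curveD(1)[OF c t] spray_curveD(2)[OF c t] spray_curveD(2)[OF c t]]
    by (simp add: g_sym[of _ "w _" "spray _ _"] g_spray force_def has_field_derivative_def lambda_zero)
  then have "\<exists>k. \<forall>t\<in>{0..1}. g (c t) (w t) (w t) = k"
    by (intro has_derivative_zero_constant) auto
  then show ?thesis using t by force
qed

lemma spray_curve_reparametrize:
  assumes c: "spray_curve c w" and ab: "0 \<le> a" "a \<le> b" "b \<le> 1"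
  shows "spray_curve (\<lambda>t. c (a + (b - a) * t)) (\<lambda>t. (b - a) *\<^sub>R w (a + (b - a) * t))"
  unfolding spray_curve_def
proof (intro ballI conjI)
  fix t :: real assume t: "t \<in> {0..1}"
  let ?h = "\<lambda>t. a + (b - a) * t"
  have h: "?h s \<in> {0..1}" if "s \<in> {0..1}" for s
  proof -
    have "(b - a) * s \<le> (b - a) * 1" using that ab by (intro mult_left_mono) auto
    then show ?thesis using that ab by auto
  qed
  then have sub: "?h ` {0..1} \<subseteq> {0..1}" by auto
  have hd: "(?h has_vector_derivative (b - a)) (at t within {0..1})"
    by (auto intro!: derivative_eq_intros)
  have chain: "((\<lambda>t. f (?h t)) has_vector_derivative (b - a) *\<^sub>R f') (at t within {0..1})"
    if "(f has_vector_derivative f') (at (?h t) within {0..1})" for f :: "real \<Rightarrow> 'a" and f'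
    using vector_diff_chain_within[OF hd has_vector_derivative_within_subset[OF that sub]] by (simp add: o_def)
  show "((\<lambda>t. c (?h t)) has_vector_derivative (b - a) *\<^sub>R w (?h t)) (at t within {0..1})"
    by (rule chain[OF spray_curveD(1)[OF c h[OF t]]])
  have "((\<lambda>t. (b - a) *\<^sub>R w (?h t)) has_vector_derivative (b - a) *\<^sub>R ((b - a) *\<^sub>R spray (c (?h t)) (w (?h t))))
      (at t within {0..1})"
    using has_vector_derivative_scaleR[OF DERIV_const chain[OF spray_curveD(2)[OF c h[OF t]]]] by simp
  then show "((\<lambda>t. (b - a) *\<^sub>R w (?h t)) has_vector_derivative
      spray (c (?h t)) ((b - a) *\<^sub>R w (?h t))) (at t within {0..1})"
    by (simp add: spray_scaleR power2_eq_square)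
qed

end

subsection \<open>Short geodesics\<close>

text \<open>Contraction principle for the velocity \<open>w\<close> of a solution \<open>c\<close> of \<open>c'' = G c c'\<close>: the constant
  of integration is adjusted so that \<open>c\<close> ends at \<open>y\<close>.\<close>

lemma two_point_problem:
  fixes G :: "'a::euclidean_space \<Rightarrow> 'a \<Rightarrow> 'a"
  assumes \<rho>: "0 < \<rho>" "\<rho> \<le> 1" and l: "0 \<le> l" "8 * l \<le> 1"
    and lip: "\<And>a b u v. a \<in> cball x \<rho> \<Longrightarrow> b \<in> cball x \<rho> \<Longrightarrow> u \<in> cball 0 \<rho> \<Longrightarrow> v \<in> cball 0 \<rho> \<Longrightarrow>
      norm (G a u - G b v) \<le> l * (norm (a - b) + norm (u - v))"
    and bd: "\<And>a u. a \<in> cball x \<rho> \<Longrightarrow> u \<in> cball 0 \<rho> \<Longrightarrow> norm (G a u) \<le> l * \<rho>"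
    and xy: "norm (y - x) \<le> \<rho> / 2"
  obtains c w where "c 0 = x" "c 1 = y"
    "\<And>t. t \<in> {0..1} \<Longrightarrow> (c has_vector_derivative w t) (at t within {0..1})"
    "\<And>t. t \<in> {0..1} \<Longrightarrow> (w has_vector_derivative G (c t) (w t)) (at t within {0..1})"
    "\<And>t. t \<in> {0..1} \<Longrightarrow> c t \<in> cball x \<rho>" "\<And>t. t \<in> {0..1} \<Longrightarrow> norm (w t) \<le> \<rho>"
proof -
  define X where "X = (cball 0 \<rho> :: (real \<Rightarrow>\<^sub>C 'a) set)"
  define pos where "pos w t = x + integral {0..t} (apply_bcontfun w)" for w and t :: real
  define acc where "acc w t = G (pos w t) (apply_bcontfun w t)" for w and t :: real
  define S where "S w t = integral {0..t} (acc w)" for w and t :: real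
  \<comment> \<open>Clamping the time to {0..1} makes the iterates bounded continuous functions on
    the whole line, that is, elements of a complete space.\<close>
  define \<tau> where "\<tau> t = max 0 (min 1 t)" for t :: real
  \<comment> \<open>Subtracting the integral of \<open>S w\<close> makes the integral of
    \<open>f w\<close> over {0..1} equal to \<open>y - x\<close>: every iterate already leads from
    \<open>x\<close> to \<open>y\<close>.\<close>
  define f where "f w t = (y - x) + S w (\<tau> t) - integral {0..1} (S w)" for w and t :: real
  have \<tau>: "\<tau> t \<in> {0..1}" for t by (auto simp: \<tau>_def)
  have \<tau>id: "\<tau> t = t" if "t \<in> {0..1}" for t using that by (auto simp: \<tau>_def)
  have wint: "apply_bcontfun w integrable_on {a..b}" for w :: "real \<Rightarrow>\<^sub>C 'a" and a b
    by (intro integrable_continuous_real) simp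
  have Xn: "norm (apply_bcontfun w t) \<le> \<rho>" if "w \<in> X" for w t
    using norm_bounded[of w t] that by (simp add: X_def)
  have dpos: "(pos w has_vector_derivative apply_bcontfun w t) (at t within {0..1})" if "t \<in> {0..1}" for w t
  proof -
    have "((\<lambda>t. x + integral {0..t} (apply_bcontfun w)) has_vector_derivative 0 + apply_bcontfun w t)
        (at t within {0..1})"
      by (intro derivative_intros integral_has_vector_derivative that) simp
    then show ?thesis by (simp add: pos_def[abs_def])
  qed
  have cpos: "continuous_on {0..1} (pos w)" for w
    using dpos has_vector_derivative_continuous continuous_on_eq_continuous_within by blast
  have bound01: "norm (integral {0..t} h) \<le> B"
    if "continuous_on {0..1} h" "\<And>s. s \<in> {0..1} \<Longrightarrow> norm (h s) \<le> B" "t \<in> {0..1}"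
    for h :: "real \<Rightarrow> 'a" and B t
  proof -
    have "norm (h 0) \<le> B" using that(2) by simp
    then have B: "B \<ge> 0" using norm_ge_zero order_trans by blast
    have "norm (integral {0..t} h) \<le> B * (t - 0)"
      by (rule integral_bound) (use that in \<open>auto intro: continuous_on_subset\<close>)
    also have "\<dots> \<le> B * 1" using that(3) B by (intro mult_left_mono) auto
    finally show ?thesis by simp
  qed
  have pin: "pos w t \<in> cball x \<rho>" if "w \<in> X" "t \<in> {0..1}" for w t
    using bound01[of "apply_bcontfun w" \<rho> t] Xn[OF that(1)] that(2) by (simp add: pos_def dist_norm)
  have contG: "continuous_on (cball x \<rho> \<times> cball 0 \<rho>) (\<lambda>a. G (fst a) (snd a))"
  proof (rule lipschitz_on_continuous_on, rule lipschitz_onI)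
    fix a b :: "'a \<times> 'a" assume ab: "a \<in> cball x \<rho> \<times> cball 0 \<rho>" "b \<in> cball x \<rho> \<times> cball 0 \<rho>"
    then have "dist (G (fst a) (snd a)) (G (fst b) (snd b)) \<le> l * (dist (fst a) (fst b) + dist (snd a) (snd b))"
      using lip[of "fst a" "fst b" "snd a" "snd b"] by (auto simp: dist_norm)
    also have "\<dots> \<le> l * (dist a b + dist a b)"
      by (intro mult_left_mono add_mono dist_fst_le dist_snd_le l)
    finally show "dist (G (fst a) (snd a)) (G (fst b) (snd b)) \<le> (2 * l) * dist a b" by simp
  qed (use l in simp)
  have cacc: "continuous_on {0..1} (acc w)" if w: "w \<in> X" for w
  proof -
    have "continuous_on {0..1} (\<lambda>t. G (fst (pos w t, apply_bcontfun w t)) (snd (pos w t, apply_bcontfun w t)))"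
      by (rule continuous_on_compose2[OF contG continuous_on_Pair[OF cpos]])
         (use pin[OF w] Xn[OF w] in auto)
    then show ?thesis by (simp add: acc_def[abs_def])
  qed
  have dS: "(S w has_vector_derivative acc w t) (at t within {0..1})" if "w \<in> X" "t \<in> {0..1}" for w t
    unfolding S_def by (rule integral_has_vector_derivative[OF cacc[OF that(1)] that(2)])
  have cS: "continuous_on {0..1} (S w)" if "w \<in> X" for w
    using dS[OF that] has_vector_derivative_continuous continuous_on_eq_continuous_within by blast
  have Sb: "norm (S w t) \<le> l * \<rho>" if "w \<in> X" "t \<in> {0..1}" for w t
    unfolding S_def
    by (rule bound01[OF cacc]) (use that pin Xn in \<open>auto simp: acc_def intro!: bd\<close>)
  have fb: "norm (f w t) \<le> \<rho>" if w: "w \<in> X" for w t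
  proof -
    have "norm (f w t) \<le> norm (y - x) + norm (S w (\<tau> t)) + norm (integral {0..1} (S w))"
      unfolding f_def by (meson norm_triangle_ineq norm_triangle_ineq4 order_trans add_right_mono)
    \<comment> \<open>By \<open>8 * l \<le> 1\<close> the last two terms add up to at most
      \<open>\<rho> / 4\<close>.\<close>
    also have "\<dots> \<le> \<rho> / 2 + l * \<rho> + l * \<rho>"
      by (intro add_mono xy Sb[OF w \<tau>] bound01[OF cS[OF w] Sb[OF w]]) auto
    also have "\<dots> \<le> \<rho>" using \<rho>(1) mult_right_mono[OF l(2), of \<rho>] by linarith
    finally show ?thesis .
  qed
  have fcont: "continuous_on UNIV (f w)" if w: "w \<in> X" for w
    unfolding f_def
    by (intro continuous_intros continuous_on_compose2[OF cS[OF w]])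
       (use \<tau> in \<open>auto simp: \<tau>_def[abs_def] intro!: continuous_intros\<close>)
  define T where "T w = Bcontfun (f w)" for w
  have T: "apply_bcontfun (T w) = f w" if "w \<in> X" for w
    unfolding T_def by (rule Bcontfun_inverse, rule bcontfun_normI[OF fcont[OF that] fb[OF that]])
  have TX: "T w \<in> X" if "w \<in> X" for w
    unfolding X_def using norm_bound[of "T w" \<rho>] fb[OF that] T[OF that] by simp
  \<comment> \<open>Position and velocity each differ by at most \<open>dist v w\<close>, so the
    accelerations differ by \<open>2 * l\<close> times this, and so do \<open>S\<close> and its
    integral. The total factor \<open>4 * l\<close> is at most 1/2.\<close>
  have contr: "dist (T v) (T w) \<le> 1/2 * dist v w" if v: "v \<in> X" and w: "w \<in> X" for v w
  proof (rule dist_bound)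
    fix t
    let ?d = "dist v w"
    have vw: "norm (apply_bcontfun v s - apply_bcontfun w s) \<le> ?d" for s
      using dist_bounded[of v s w] by (simp add: dist_norm)
    have pd: "norm (pos v s - pos w s) \<le> ?d" if "s \<in> {0..1}" for s
    proof -
      have "pos v s - pos w s = integral {0..s} (\<lambda>r. apply_bcontfun v r - apply_bcontfun w r)"
        by (simp add: pos_def integral_diff wint)
      also have "norm \<dots> \<le> ?d"
        by (rule bound01[OF _ vw that]) (intro continuous_intros continuous_on_apply_bcontfun)
      finally show ?thesis .
    qed
    have ad: "norm (acc v s - acc w s) \<le> 2 * l * ?d" if s: "s \<in> {0..1}" for s
    proof -
      have "norm (acc v s - acc w s) \<le> l * (norm (pos v s - pos w s) + norm (apply_bcontfun v s - apply_bcontfun w s))"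
        unfolding acc_def using pin Xn v w s by (intro lip) auto
      also have "\<dots> \<le> l * (?d + ?d)" by (intro mult_left_mono add_mono pd vw s l)
      finally show ?thesis by simp
    qed
    have Sd: "norm (S v s - S w s) \<le> 2 * l * ?d" if s: "s \<in> {0..1}" for s
    proof -
      have "acc u integrable_on {0..s}" if "u \<in> X" for u
        by (intro integrable_continuous_real continuous_on_subset[OF cacc[OF that]]) (use s in auto)
      then have "S v s - S w s = integral {0..s} (\<lambda>r. acc v r - acc w r)"
        using v w by (simp add: S_def integral_diff)
      also have "norm \<dots> \<le> 2 * l * ?d"
        by (rule bound01[OF _ ad s]) (auto intro!: continuous_intros cacc v w)
      finally show ?thesis .
    qed
    have "integral {0..1} (S v) - integral {0..1} (S w) = integral {0..1} (\<lambda>s. S v s - S w s)"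
      by (intro integral_diff[symmetric] integrable_continuous_real cS v w)
    also have "norm \<dots> \<le> 2 * l * ?d"
      by (rule bound01[OF _ Sd]) (auto intro!: continuous_intros cS v w)
    finally have Id: "norm (integral {0..1} (S v) - integral {0..1} (S w)) \<le> 2 * l * ?d" .
    have "dist (apply_bcontfun (T v) t) (apply_bcontfun (T w) t)
        = norm ((S v (\<tau> t) - S w (\<tau> t)) - (integral {0..1} (S v) - integral {0..1} (S w)))"
      by (simp add: T v w f_def dist_norm algebra_simps)
    also have "\<dots> \<le> 2 * l * ?d + 2 * l * ?d"
      by (intro order_trans[OF norm_triangle_ineq4] add_mono Sd \<tau> Id)
    also have "\<dots> \<le> 1/2 * ?d" using mult_right_mono[OF l(2), of ?d] zero_le_dist[of v w] by linarith
    finally show "dist (apply_bcontfun (T v) t) (apply_bcontfun (T w) t) \<le> 1/2 * dist v w" .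
  qed
  have "\<exists>!w. w \<in> X \<and> T w = w"
  proof (rule Banach_fix[where c = "1/2"])
    show "T ` X \<subseteq> X" using TX by blast
    show "complete X" by (simp add: X_def complete_eq_closed)
    show "X \<noteq> {}" using \<rho>(1) by (simp add: X_def)
  qed (use contr in auto)
  then obtain W where W: "W \<in> X" "T W = W" by blast
  define w where "w = apply_bcontfun W"
  have weq: "w t = (y - x) + S W t - integral {0..1} (S W)" if "t \<in> {0..1}" for t
    using T[OF W(1)] \<tau>id[OF that] by (simp add: W(2) w_def f_def)
  have "(w has_vector_derivative G (pos W t) (w t)) (at t within {0..1})" if t: "t \<in> {0..1}" for t
  proof -
    have "((\<lambda>t. (y - x) + S W t - integral {0..1} (S W)) has_vector_derivative (0 + acc W t - 0)) (at t within {0..1})"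
      by (intro derivative_intros dS[OF W(1) t])
    then have "((\<lambda>t. (y - x) + S W t - integral {0..1} (S W)) has_vector_derivative G (pos W t) (w t)) (at t within {0..1})"
      by (simp add: acc_def w_def)
    then show ?thesis by (rule has_vector_derivative_transform[OF t, rotated]) (rule weq)
  qed
  moreover have "pos W 1 = y"
  proof -
    have "integral {0..1} w = integral {0..1} (\<lambda>t. ((y - x) - integral {0..1} (S W)) + S W t)"
      by (rule Henstock_Kurzweil_Integration.integral_cong) (simp add: weq)
    also have "\<dots> = integral {0..1} (\<lambda>t::real. (y - x) - integral {0..1} (S W)) + integral {0..1} (S W)"
      by (intro integral_add integrable_continuous_real cS W continuous_on_const)
    finally show ?thesis by (simp add: pos_def w_def)
  qed
  moreover have "pos W 0 = x" by (simp add: pos_def)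
  ultimately show thesis
    using that[of "pos W" w] dpos[of _ W] pin[OF W(1)] Xn[OF W(1)] by (simp add: w_def)
qed

context riemannian
begin

lemma g_bounded:
  obtains B where "B \<ge> 0" "\<And>x u. x \<in> cball 0 R \<Longrightarrow> g x u u \<le> B * (norm u)\<^sup>2"
proof -
  define S where "S = cball (0::'a) R \<times> sphere (0::'a) 1"
  have "compact S" by (simp add: S_def compact_Times)
  moreover have "continuous_on S (\<lambda>a. g (fst a) (snd a) (snd a))" by (intro continuous_intros)
  ultimately have "bounded ((\<lambda>a. g (fst a) (snd a) (snd a)) ` S)"
    by (intro compact_imp_bounded compact_continuous_image)
  then obtain B where B: "\<And>a. a \<in> S \<Longrightarrow> \<bar>g (fst a) (snd a) (snd a)\<bar> \<le> B" unfolding bounded_iff by auto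
  have "g x u u \<le> \<bar>B\<bar> * (norm u)\<^sup>2" if x: "x \<in> cball 0 R" for x u
  proof (cases "u = 0")
    case False
    have "g x u u / (norm u)\<^sup>2 = g x (u /\<^sub>R norm u) (u /\<^sub>R norm u)"
      using False by (simp add: g_linear power2_eq_square field_simps)
    also have "\<dots> \<le> \<bar>B\<bar>"
      using B[of "(x, u /\<^sub>R norm u)"] x False by (simp add: S_def)
    finally show ?thesis using False by (simp add: field_simps)
  qed (simp add: g_linear)
  then show thesis using that[of "\<bar>B\<bar>"] by simp
qed

text \<open>By homogeneity the spray has Lipschitz constant \<open>M * \<rho>\<close> on velocities
  of norm at most \<rho>, so a small \<rho> meets the smallness condition of
  \<open>two_point_problem\<close>. The bound 1 on the squared speed is the normalisation used for
  counting later.\<close>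

lemma short_spray_curve:
  assumes U: "open U" and p: "p \<in> U"
  obtains \<epsilon> where "\<epsilon> > 0" "\<And>x y. x \<in> ball p \<epsilon> \<Longrightarrow> y \<in> ball p \<epsilon> \<Longrightarrow>
    \<exists>c w. spray_curve c w \<and> c 0 = x \<and> c 1 = y \<and> c ` {0..1} \<subseteq> U \<and> g (c 0) (w 0) (w 0) < 1"
proof -
  obtain r where r: "r > 0" "cball p r \<subseteq> U" using U p by (meson open_contains_cball)
  define R where "R = norm p + r + 1"
  have R1: "R \<ge> 1" using r(1) by (simp add: R_def)
  have pR: "cball p r \<subseteq> cball 0 R"
  proof
    fix z assume "z \<in> cball p r"
    then show "z \<in> cball 0 R"
      using norm_triangle_ineq2[of z p] by (simp add: R_def dist_norm norm_minus_commute)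
  qed
  obtain B where B: "B \<ge> 0" "\<And>x u. x \<in> cball 0 R \<Longrightarrow> g x u u \<le> B * (norm u)\<^sup>2"
    using g_bounded by metis
  obtain M where M: "M-lipschitz_on (cball 0 R \<times> cball 0 R) (\<lambda>a. spray (fst a) (snd a))"
    by (rule spray_lipschitz)
  have M0: "M \<ge> 0" using M by (rule lipschitz_on_nonneg)
  \<comment> \<open>\<open>1 / (8 * M + 1)\<close> yields \<open>8 * (M * \<rho>) \<le> 1\<close>,
    \<open>1 / (B + 1)\<close> keeps the squared speed below 1, and \<open>r / 2\<close> keeps
    \<open>cball x \<rho>\<close> inside \<open>cball p r\<close>.\<close>
  define \<rho> where "\<rho> = min (min 1 (r / 2)) (min (1 / (8 * M + 1)) (1 / (B + 1)))"
  have \<rho>: "0 < \<rho>" "\<rho> \<le> 1" "\<rho> \<le> r / 2" using r(1) M0 B(1) by (auto simp: \<rho>_def)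
  have "\<rho> * (8 * M + 1) \<le> 1 / (8 * M + 1) * (8 * M + 1)"
    using M0 by (intro mult_right_mono) (auto simp: \<rho>_def)
  then have M\<rho>: "8 * (M * \<rho>) \<le> 1" using M0 \<rho>(1) by (simp add: algebra_simps)
  have "\<rho> * (B + 1) \<le> 1 / (B + 1) * (B + 1)"
    using B(1) by (intro mult_right_mono) (auto simp: \<rho>_def)
  then have "B * \<rho> < 1" using B(1) \<rho>(1) by (simp add: algebra_simps)
  moreover have "B * \<rho> * \<rho> \<le> B * \<rho> * 1" using B(1) \<rho> by (intro mult_left_mono) auto
  ultimately have B\<rho>: "B * \<rho>\<^sup>2 < 1" by (simp add: power2_eq_square)
  have lip: "norm (spray a u - spray b v) \<le> (M * \<rho>) * (norm (a - b) + norm (u - v))"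
    if "a \<in> cball 0 R" "b \<in> cball 0 R" "u \<in> cball 0 \<rho>" "v \<in> cball 0 \<rho>" for a b u v
  proof -
    \<comment> \<open>Velocities are rescaled to the unit ball, where \<open>M\<close> applies since
      \<open>R \<ge> 1\<close>. The factor \<open>\<rho>\<^sup>2\<close> outweighs the division by
      \<rho> and leaves one factor \<rho>.\<close>
    have s: "spray z q = \<rho>\<^sup>2 *\<^sub>R spray z (q /\<^sub>R \<rho>)" for z q
      using spray_scaleR[of z \<rho> "q /\<^sub>R \<rho>"] \<rho>(1) by simp
    have in1: "q /\<^sub>R \<rho> \<in> cball 0 R" if "q \<in> cball 0 \<rho>" for q :: 'a
    proof -
      have "norm q / \<rho> \<le> 1" using that \<rho>(1) by simp
      then show ?thesis using R1 \<rho>(1) by (simp add: divide_inverse mult.commute)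
    qed
    have "norm (spray a u - spray b v) = \<rho>\<^sup>2 * norm (spray a (u /\<^sub>R \<rho>) - spray b (v /\<^sub>R \<rho>))"
      by (subst (1 2) s) (simp flip: scaleR_diff_right)
    also have "\<dots> \<le> \<rho>\<^sup>2 * (M * dist (a, u /\<^sub>R \<rho>) (b, v /\<^sub>R \<rho>))"
      using lipschitz_onD[OF M, of "(a, u /\<^sub>R \<rho>)" "(b, v /\<^sub>R \<rho>)"] that in1
      by (intro mult_left_mono) (auto simp: dist_norm)
    also have "dist (a, u /\<^sub>R \<rho>) (b, v /\<^sub>R \<rho>) \<le> norm (a - b) + norm (u - v) / \<rho>"
    proof -
      have "dist (u /\<^sub>R \<rho>) (v /\<^sub>R \<rho>) = norm (u - v) / \<rho>"
        using \<rho>(1) by (simp add: dist_norm divide_inverse mult.commute flip: scaleR_diff_right)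
      then show ?thesis
        using sqrt_sum_squares_le_sum[OF zero_le_dist zero_le_dist, of a b "u /\<^sub>R \<rho>" "v /\<^sub>R \<rho>"]
        unfolding dist_Pair_Pair by (simp add: dist_norm)
    qed
    also have "\<rho>\<^sup>2 * (M * (norm (a - b) + norm (u - v) / \<rho>)) = M * \<rho> * (\<rho> * norm (a - b) + norm (u - v))"
      using \<rho>(1) by (simp add: power2_eq_square field_simps)
    also have "\<dots> \<le> M * \<rho> * (1 * norm (a - b) + norm (u - v))"
      using M0 \<rho> by (intro mult_left_mono add_right_mono mult_right_mono) auto
    finally show ?thesis using M0 \<rho>(1) by (simp add: mult_left_mono)
  qed
  \<comment> \<open>Two points of the ball are then at distance less than
    \<open>\<rho> / 2\<close>.\<close>
  define \<epsilon> where "\<epsilon> = \<rho> / 4"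
  have "\<exists>c w. spray_curve c w \<and> c 0 = x \<and> c 1 = y \<and> c ` {0..1} \<subseteq> U \<and> g (c 0) (w 0) (w 0) < 1"
    if x: "x \<in> ball p \<epsilon>" and y: "y \<in> ball p \<epsilon>" for x y
  proof -
    have sub: "cball x \<rho> \<subseteq> cball p r"
    proof
      fix z assume "z \<in> cball x \<rho>"
      then show "z \<in> cball p r"
        using dist_triangle[of p z x] x \<rho> by (simp add: \<epsilon>_def)
    qed
    have xy: "norm (y - x) \<le> \<rho> / 2"
      using dist_triangle[of y x p] x y by (simp add: \<epsilon>_def dist_norm norm_minus_commute)
    have bd: "norm (spray a u) \<le> M * \<rho> * \<rho>" if "a \<in> cball x \<rho>" "u \<in> cball 0 \<rho>" for a u
    proof -
      have "norm (spray a u - spray a 0) \<le> M * \<rho> * (norm (a - a) + norm (u - 0))"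
        by (rule lip) (use that subsetD[OF pR subsetD[OF sub]] \<rho> in auto)
      also have "\<dots> \<le> M * \<rho> * \<rho>" using that M0 \<rho>(1) by (intro mult_left_mono) auto
      finally show ?thesis by simp
    qed
    obtain c w where c: "c 0 = x" "c 1 = y"
      "\<And>t. t \<in> {0..1} \<Longrightarrow> (c has_vector_derivative w t) (at t within {0..1})"
      "\<And>t. t \<in> {0..1} \<Longrightarrow> (w has_vector_derivative spray (c t) (w t)) (at t within {0..1})"
      "\<And>t. t \<in> {0..1} \<Longrightarrow> c t \<in> cball x \<rho>" "\<And>t. t \<in> {0..1} \<Longrightarrow> norm (w t) \<le> \<rho>"
    proof (rule two_point_problem[OF \<rho>(1,2) _ M\<rho> _ bd xy])
      show "norm (spray a u - spray b v) \<le> M * \<rho> * (norm (a - b) + norm (u - v))"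
        if "a \<in> cball x \<rho>" "b \<in> cball x \<rho>" "u \<in> cball 0 \<rho>" "v \<in> cball 0 \<rho>" for a b u v
        by (rule lip) (use that subsetD[OF pR subsetD[OF sub]] in auto)
    qed (use M0 \<rho>(1) in auto)
    have "c 0 \<in> cball 0 R" using subsetD[OF pR subsetD[OF sub c(5)[of 0]]] by simp
    then have "g (c 0) (w 0) (w 0) \<le> B * (norm (w 0))\<^sup>2" by (rule B)
    also have "\<dots> \<le> B * \<rho>\<^sup>2" using c(6)[of 0] B(1) by (intro mult_left_mono power_mono) auto
    also have "\<dots> < 1" by (rule B\<rho>)
    finally have "g (c 0) (w 0) (w 0) < 1" .
    moreover have "c ` {0..1} \<subseteq> U" using c(5) sub r(2) by blast
    ultimately show ?thesis using c unfolding spray_curve_def by blast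
  qed
  then show thesis using that[of \<epsilon>] \<rho>(1) by (simp add: \<epsilon>_def)
qed

end

subsection \<open>The inverse exponential map\<close>

context riemannian
begin

lemma geodesic_in_iff_spray_curve:
  "geodesic_in g U x y c \<longleftrightarrow> spray_curve c (velocity c) \<and> c 0 = x \<and> c 1 = y \<and> c ` {0..1} \<subseteq> U"
  unfolding geodesic_in_def using geodesic_imp_spray_curve spray_curve_imp_geodesic by blast

lemma spray_curve_geodesic_in:
  "spray_curve c w \<Longrightarrow> c ` {0..1} \<subseteq> U \<Longrightarrow> geodesic_in g U (c 0) (c 1) c"
  unfolding geodesic_in_def using spray_curve_imp_geodesic by blast

text \<open>Uniqueness for boundary data, from g-convexity. Curves that agree on {0..1} have equal
  one-sided derivatives, also at the end points, hence equal velocities.\<close>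

lemma spray_curve_unique:
  assumes U: "g_convex_set g U"
    and c: "spray_curve c w" "c ` {0..1} \<subseteq> U" and d: "spray_curve d v" "d ` {0..1} \<subseteq> U"
    and eq: "c 0 = d 0" "c 1 = d 1" and t: "t \<in> {0..1}"
  shows "w t = v t"
proof -
  have "c 0 \<in> U" "c 1 \<in> U" using c(2) by auto
  then have cd: "d s = c s" if "s \<in> {0..1}" for s
    using U spray_curve_geodesic_in[OF c] spray_curve_geodesic_in[OF d] that
    unfolding g_convex_set_def eq by metis
  have "(d has_vector_derivative w t) (at t within {0..1})"
    using cd by (intro has_vector_derivative_transform[OF t _ spray_curveD(1)[OF c(1) t]]) auto
  then show ?thesis
    using velocity_eq[OF _ t] spray_curveD(6)[OF d(1) t] by metis
qed

lemma Exp_inv_eq: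
  assumes U: "g_convex_set g U" and c: "spray_curve c w" "c ` {0..1} \<subseteq> U" "c 0 = x" "c 1 = y"
  shows "Exp_inv g U x y = w 0"
  unfolding Exp_inv_def
proof (rule the_equality)
  show "\<exists>\<gamma>. geodesic_in g U x y \<gamma> \<and> velocity \<gamma> 0 = w 0"
    using spray_curve_geodesic_in[OF c(1,2)] spray_curveD(6)[OF c(1), of 0] c(3,4) by auto
  fix v assume "\<exists>\<gamma>. geodesic_in g U x y \<gamma> \<and> velocity \<gamma> 0 = v"
  then obtain \<gamma> where \<gamma>: "spray_curve \<gamma> (velocity \<gamma>)" "\<gamma> 0 = x" "\<gamma> 1 = y" "\<gamma> ` {0..1} \<subseteq> U" "velocity \<gamma> 0 = v"
    unfolding geodesic_in_iff_spray_curve by blast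
  show "v = w 0"
    using spray_curve_unique[OF U \<gamma>(1,4) c(1,2), of 0] \<gamma> c by simp
qed

lemma spray_curve_to:
  assumes "g_convex_set g U" "x \<in> U" "y \<in> U"
  obtains c where "spray_curve c (velocity c)" "c 0 = x" "c 1 = y" "c ` {0..1} \<subseteq> U"
  using assms unfolding g_convex_set_def geodesic_in_iff_spray_curve by blast

text \<open>With \<open>n\<close> balls, two of the \<open>n + 1\<close> times \<open>k / n\<close>
  fall into the same ball. The arc between them, stretched to {0..1}, has its squared speed
  multiplied by a factor of at least \<open>1 / n\<^sup>2\<close>, and it coincides with the short
  geodesic, whose squared speed is below 1. This gives the bound \<open>n\<^sup>2\<close>, which
  does not depend on the curve.\<close>

lemma spray_curve_speed_bound:
  assumes U: "open U" "g_convex_set g U" and K: "compact K" "K \<subseteq> U"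
  obtains N where "\<And>c w. spray_curve c w \<Longrightarrow> c ` {0..1} \<subseteq> K \<Longrightarrow> g (c 0) (w 0) (w 0) \<le> N"
proof -
  have "\<exists>\<epsilon>>0. \<forall>x\<in>ball p \<epsilon>. \<forall>y\<in>ball p \<epsilon>.
      \<exists>c w. spray_curve c w \<and> c 0 = x \<and> c 1 = y \<and> c ` {0..1} \<subseteq> U \<and> g (c 0) (w 0) (w 0) < 1"
    if "p \<in> K" for p
  proof -
    have "p \<in> U" using that K(2) by blast
    show ?thesis by (rule short_spray_curve[OF U(1) \<open>p \<in> U\<close>]) blast
  qed
  then obtain \<epsilon> where \<epsilon>: "\<And>p. p \<in> K \<Longrightarrow> \<epsilon> p > 0"
    and short: "\<And>p x y. p \<in> K \<Longrightarrow> x \<in> ball p (\<epsilon> p) \<Longrightarrow> y \<in> ball p (\<epsilon> p) \<Longrightarrow>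
      \<exists>c w. spray_curve c w \<and> c 0 = x \<and> c 1 = y \<and> c ` {0..1} \<subseteq> U \<and> g (c 0) (w 0) (w 0) < 1"
    by metis
  have "K \<subseteq> (\<Union>p\<in>K. ball p (\<epsilon> p))" using \<epsilon> by force
  then obtain C where C: "C \<subseteq> K" "finite C" "K \<subseteq> (\<Union>p\<in>C. ball p (\<epsilon> p))"
    using compactE_image[OF K(1), of K "\<lambda>p. ball p (\<epsilon> p)"] by auto
  define n where "n = card C"
  have "g (c 0) (w 0) (w 0) \<le> (real n)\<^sup>2" if c: "spray_curve c w" and cK: "c ` {0..1} \<subseteq> K" for c w
  proof -
    have "c 0 \<in> K" using cK by auto
    then have "C \<noteq> {}" using C(3) by auto
    then have n: "n > 0" using C(2) by (simp add: n_def card_gt_0_iff)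
    have "\<exists>p\<in>C. c (real k / real n) \<in> ball p (\<epsilon> p)" if "k \<in> {0..n}" for k
    proof -
      have "real k / real n \<in> {0..1}" using that n by simp
      then have "c (real k / real n) \<in> K" using cK by blast
      then show ?thesis using C(3) by blast
    qed
    then obtain h where h: "\<And>k. k \<in> {0..n} \<Longrightarrow> h k \<in> C"
      "\<And>k. k \<in> {0..n} \<Longrightarrow> c (real k / real n) \<in> ball (h k) (\<epsilon> (h k))" by metis
    have "card (h ` {0..n}) \<le> n" unfolding n_def using h(1) C(2) n_def by (intro card_mono) auto
    then have "\<not> inj_on h {0..n}" by (intro pigeonhole) simp
    then obtain i k where "i \<in> {0..n}" "k \<in> {0..n}" "i \<noteq> k" "h i = h k"
      unfolding inj_on_def by blast
    then obtain i k where ik: "i \<in> {0..n}" "k \<in> {0..n}" "i < k" "h i = h k"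
      by (metis linorder_neqE_nat)
    define a b where "a = real i / real n" and "b = real k / real n"
    have ab: "0 \<le> a" "a \<le> b" "b \<le> 1" using ik n by (auto simp: a_def b_def divide_right_mono)
    have ba: "1 / real n \<le> b - a"
      using ik(3) n by (simp add: a_def b_def divide_right_mono flip: diff_divide_distrib)
    have "h i \<in> K" using h(1)[OF ik(1)] C(1) by blast
    then obtain d v where d: "spray_curve d v" "d 0 = c a" "d 1 = c b" "d ` {0..1} \<subseteq> U" "g (d 0) (v 0) (v 0) < 1"
      using short[of "h i" "c a" "c b"] h(2)[OF ik(1)] h(2)[OF ik(2)] ik(4) unfolding a_def b_def by metis
    let ?c = "\<lambda>t. c (a + (b - a) * t)" and ?w = "\<lambda>t. (b - a) *\<^sub>R w (a + (b - a) * t)"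
    have rc: "spray_curve ?c ?w" by (rule spray_curve_reparametrize[OF c ab])
    have "a + (b - a) * t \<in> {0..1}" if "t \<in> {0..1}" for t
    proof -
      have "(b - a) * t \<le> (b - a) * 1" using that ab by (intro mult_left_mono) auto
      then show ?thesis using that ab by auto
    qed
    \<comment> \<open>The comparison takes place in \<open>U\<close>: the arc stays in
      \<open>K\<close>, but the short geodesic is only known to stay in \<open>U\<close>.\<close>
    then have "?c ` {0..1} \<subseteq> U" using cK K(2) by blast
    from spray_curve_unique[OF U(2) rc this d(1,4), of 0]
    have v: "v 0 = (b - a) *\<^sub>R w a" using d by simp
    have "g (c a) (w a) (w a) = g (c 0) (w 0) (w 0)"
      by (rule spray_curve_constant_speed[OF c]) (use ab in auto)
    then have lt: "(b - a)\<^sup>2 * g (c 0) (w 0) (w 0) < 1"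
      using d(5) by (simp add: d(2) v g_linear power2_eq_square mult.assoc)
    have "0 \<le> g (c 0) (w 0) (w 0)"
      using g_pos[of "w 0" "c 0"] by (cases "w 0 = 0") (auto simp: g_linear less_imp_le)
    moreover have "(1 / real n)\<^sup>2 \<le> (b - a)\<^sup>2" using ba by (intro power_mono) auto
    ultimately have "(1 / real n)\<^sup>2 * g (c 0) (w 0) (w 0) < 1"
      using lt mult_right_mono by (meson le_less_trans)
    then show ?thesis using n by (simp add: power_divide field_simps)
  qed
  then show thesis by (rule that)
qed

text \<open>Pairs of position and velocity are exact integral curves of one continuous field with
  values in a compact set. Working with pairs makes the velocities converge too, so the limit again
  solves the geodesic equation.\<close>

lemma spray_curves_compact:
  fixes c w :: "nat \<Rightarrow> real \<Rightarrow> 'a"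
  assumes K: "compact K"
    and c: "\<And>n. spray_curve (c n) (w n)" "\<And>n. c n ` {0..1} \<subseteq> K"
    and B: "\<And>n t. t \<in> {0..1} \<Longrightarrow> norm (w n t) \<le> B"
  obtains d v r where "strict_mono r" "spray_curve d v" "d ` {0..1} \<subseteq> K"
    "\<forall>t\<in>{0..1}. (\<lambda>n. c (r n) t) \<longlonglongrightarrow> d t" "\<forall>t\<in>{0..1}. (\<lambda>n. w (r n) t) \<longlonglongrightarrow> v t"
proof -
  define f where "f a = (snd a, spray (fst a) (snd a))" for a :: "'a \<times> 'a"
  define Z where "Z = K \<times> cball (0::'a) B"
  define z where "z n t = (c n t, w n t)" for n t
  have Z: "compact Z" using K by (simp add: Z_def compact_Times)
  have f: "continuous_on UNIV f" unfolding f_def by (intro continuous_intros)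
  then have fZ: "continuous_on Z f" by (rule continuous_on_subset) simp
  have zZ: "z n t \<in> Z" if "t \<in> {0..1}" for n t
    using c(2)[of n] B[OF that, of n] that by (auto simp: z_def Z_def)
  have dz: "(z n has_vector_derivative f (z n t)) (at t within {0..1})" if "t \<in> {0..1}" for n t
    using has_vector_derivative_Pair[OF spray_curveD(1,2)[OF c(1) that]] by (simp add: z_def[abs_def] f_def)
  have "bounded (f ` Z)" by (intro compact_imp_bounded compact_continuous_image fZ Z)
  then obtain L where L: "\<And>a. a \<in> Z \<Longrightarrow> norm (f a) \<le> L" unfolding bounded_iff by blast
  have lip: "\<bar>L\<bar>-lipschitz_on {0..1} (z n)" for n
  proof (rule lipschitz_onI)
    fix s t :: real assume st: "s \<in> {0..1}" "t \<in> {0..1}"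
    have "norm (z n s - z n t) \<le> \<bar>L\<bar> * norm (s - t)"
    proof (rule differentiable_bound[OF _ _ _ st])
      fix u :: real assume u: "u \<in> {0..1}"
      show "(z n has_derivative (\<lambda>h. h *\<^sub>R f (z n u))) (at u within {0..1})"
        using dz[OF u] by (simp add: has_vector_derivative_def)
      show "onorm (\<lambda>h. h *\<^sub>R f (z n u)) \<le> \<bar>L\<bar>"
      proof (rule onorm_le)
        fix h :: real
        have "norm (h *\<^sub>R f (z n u)) \<le> \<bar>h\<bar> * \<bar>L\<bar>"
          using L[OF zZ[OF u], of n] by (simp add: mult_left_mono)
        then show "norm (h *\<^sub>R f (z n u)) \<le> \<bar>L\<bar> * norm h" by (simp add: mult.commute)
      qed
    qed simp
    then show "dist (z n s) (z n t) \<le> \<bar>L\<bar> * dist s t" by (simp add: dist_norm)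
  qed simp
  have err: "norm (z n t - (z n 0 + integral {0..t} (\<lambda>s. f (z n s)))) \<le> 0" if t: "t \<in> {0..1}" for n t
  proof -
    have "((\<lambda>s. f (z n s)) has_integral z n t - z n 0) {0..t}"
    proof (rule fundamental_theorem_of_calculus)
      fix s assume "s \<in> {0..t}"
      then show "(z n has_vector_derivative f (z n s)) (at s within {0..t})"
        using has_vector_derivative_within_subset[OF dz[of s n], of "{0..t}"] t by auto
    qed (use t in auto)
    then show ?thesis by (simp add: integral_unique)
  qed
  obtain u r where r: "strict_mono r"
    and lim: "\<forall>t\<in>{0..1}. (\<lambda>n. z (r n) t) \<longlonglongrightarrow> u t"
    and uZ: "\<forall>t\<in>{0..1}. u t \<in> Z"
    and du: "\<forall>t\<in>{0..1}. (u has_vector_derivative f (u t)) (at t within {0..1})"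
    by (rule approximate_solutions_limit[where z = z and e = "\<lambda>_. 0", OF fZ Z zZ lip err tendsto_const]) blast
  define d v where "d t = fst (u t)" and "v t = snd (u t)" for t
  have "spray_curve d v"
    unfolding spray_curve_def
  proof (intro ballI conjI)
    fix t :: real assume t: "t \<in> {0..1}"
    note D = bspec[OF du t, unfolded has_vector_derivative_def]
    show "(d has_vector_derivative v t) (at t within {0..1})"
      using has_derivative_fst[OF D] by (simp add: has_vector_derivative_def d_def[abs_def] v_def f_def)
    show "(v has_vector_derivative spray (d t) (v t)) (at t within {0..1})"
      using has_derivative_snd[OF D] by (simp add: has_vector_derivative_def d_def[abs_def] v_def[abs_def] f_def)
  qed
  moreover have "d ` {0..1} \<subseteq> K" using uZ by (force simp: Z_def d_def mem_Times_iff)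
  moreover have "\<forall>t\<in>{0..1}. (\<lambda>n. c (r n) t) \<longlonglongrightarrow> d t"
    using lim tendsto_fst by (fastforce simp: z_def d_def)
  moreover have "\<forall>t\<in>{0..1}. (\<lambda>n. w (r n) t) \<longlonglongrightarrow> v t"
    using lim tendsto_snd by (fastforce simp: z_def v_def)
  ultimately show thesis by (rule that[OF r])
qed

text \<open>A map into a compact ball is continuous if its graph is closed. To identify the limit of
  initial velocities, whole geodesics must converge: only then does the limit curve end at
  \<open>y\<close> and stay in \<open>K\<close>, so that its initial velocity is the value of
  \<open>Exp_inv\<close>.\<close>

lemma continuous_on_Exp_inv:
  assumes U: "open U" "g_convex_set g U" and K: "compact K" "K \<subseteq> U" and y: "y \<in> U"
    and inK: "\<And>x c. x \<in> K \<Longrightarrow> geodesic_in g U x y c \<Longrightarrow> c ` {0..1} \<subseteq> K"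
  shows "continuous_on K (\<lambda>x. Exp_inv g U x y)"
proof -
  let ?E = "\<lambda>x. Exp_inv g U x y"
  have "\<exists>c w. spray_curve c w \<and> c ` {0..1} \<subseteq> K \<and> c 0 = x \<and> c 1 = y \<and> w 0 = ?E x" if x: "x \<in> K" for x
  proof -
    have "x \<in> U" using x K by blast
    then obtain c where c: "spray_curve c (velocity c)" "c 0 = x" "c 1 = y" "c ` {0..1} \<subseteq> U"
      using spray_curve_to[OF U(2) _ y] by metis
    moreover have "c ` {0..1} \<subseteq> K"
      by (rule inK[OF x]) (use c in \<open>simp add: geodesic_in_iff_spray_curve\<close>)
    ultimately show ?thesis using Exp_inv_eq[OF U(2) c(1,4,2,3)] by metis
  qed
  then obtain C W where C: "\<And>x. x \<in> K \<Longrightarrow> spray_curve (C x) (W x)" "\<And>x. x \<in> K \<Longrightarrow> C x ` {0..1} \<subseteq> K"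
    "\<And>x. x \<in> K \<Longrightarrow> C x 0 = x" "\<And>x. x \<in> K \<Longrightarrow> C x 1 = y" "\<And>x. x \<in> K \<Longrightarrow> W x 0 = ?E x"
    by metis
  obtain N where N: "\<And>c w. spray_curve c w \<Longrightarrow> c ` {0..1} \<subseteq> K \<Longrightarrow> g (c 0) (w 0) (w 0) \<le> N"
    using spray_curve_speed_bound[OF U K] by blast
  obtain R where R: "\<And>x. x \<in> K \<Longrightarrow> norm x \<le> R"
    using compact_imp_bounded[OF K(1)] unfolding bounded_iff by blast
  obtain \<kappa> where \<kappa>: "\<kappa> > 0" "\<And>x u. x \<in> cball 0 R \<Longrightarrow> \<kappa> * (norm u)\<^sup>2 \<le> g x u u"
    using g_elliptic by metis
  \<comment> \<open>Constancy of the speed and ellipticity on a ball containing \<open>K\<close>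
    turn the bound \<open>N\<close> at time 0 into a norm bound at all times.\<close>
  define B where "B = sqrt (N / \<kappa>)"
  have B: "norm (W x t) \<le> B" if x: "x \<in> K" and t: "t \<in> {0..1}" for x t
  proof -
    have "C x t \<in> K" using C(2)[OF x] t by blast
    then have "\<kappa> * (norm (W x t))\<^sup>2 \<le> g (C x t) (W x t) (W x t)" using \<kappa>(2) R by simp
    also have "\<dots> = g (C x 0) (W x 0) (W x 0)"
      by (rule spray_curve_constant_speed[OF C(1)[OF x] t])
    also have "\<dots> \<le> N" by (rule N[OF C(1)[OF x] C(2)[OF x]])
    finally have "(norm (W x t))\<^sup>2 \<le> N / \<kappa>" using \<kappa>(1) by (simp add: field_simps)
    then show ?thesis unfolding B_def by (rule real_le_rsqrt)
  qed
  show ?thesis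
  proof (rule continuous_from_closed_graph)
    show "compact (cball (0::'a) B)" by simp
    show "?E \<in> K \<rightarrow> cball 0 B" using B[of _ 0] C(5) by auto
    show "closed ((\<lambda>x. (x, ?E x)) ` K)"
      unfolding closed_sequential_limits
    proof (intro allI impI)
      fix s l assume "(\<forall>n. s n \<in> (\<lambda>x. (x, ?E x)) ` K) \<and> s \<longlonglongrightarrow> l"
      then have sK: "\<And>n. s n \<in> (\<lambda>x. (x, ?E x)) ` K" and sl: "s \<longlonglongrightarrow> l" by auto
      define X where "X n = fst (s n)" for n
      have X: "X n \<in> K" "snd (s n) = ?E (X n)" for n using sK[of n] by (auto simp: X_def)
      obtain d v r where r: "strict_mono r" and d: "spray_curve d v" "d ` {0..1} \<subseteq> K"
        and dlim: "\<forall>t\<in>{0..1}. (\<lambda>n. C (X (r n)) t) \<longlonglongrightarrow> d t"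
        and vlim: "\<forall>t\<in>{0..1}. (\<lambda>n. W (X (r n)) t) \<longlonglongrightarrow> v t"
        by (rule spray_curves_compact[where c = "\<lambda>n. C (X n)" and w = "\<lambda>n. W (X n)",
              OF K(1) C(1)[OF X(1)] C(2)[OF X(1)] B[OF X(1)]]) blast
      have sr: "(\<lambda>n. s (r n)) \<longlonglongrightarrow> l" using LIMSEQ_subseq_LIMSEQ[OF sl r] by (simp add: o_def)
      have "d 0 = fst l"
        using LIMSEQ_unique[OF bspec[OF dlim, of 0]] tendsto_fst[OF sr] C(3)[OF X(1)] by (simp add: X_def)
      moreover have "v 0 = snd l"
        using LIMSEQ_unique[OF bspec[OF vlim, of 0]] tendsto_snd[OF sr] C(5)[OF X(1)] X(2) by simp
      moreover have "d 0 \<in> K" using d(2) by (simp add: image_subset_iff)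
      moreover have "d 1 = y" using LIMSEQ_unique[OF bspec[OF dlim, of 1]] C(4)[OF X(1)] by simp
      ultimately have "?E (fst l) = snd l" "fst l \<in> K"
        using Exp_inv_eq[OF U(2) d(1) order_trans[OF d(2) K(2)]] by simp_all
      then show "l \<in> (\<lambda>x. (x, ?E x)) ` K" by (intro image_eqI[of _ _ "fst l"]) (simp_all add: prod_eq_iff)
    qed
  qed
qed

lemma Exp_inv_self:
  assumes "g_convex_set g U" "x \<in> U"
  shows "Exp_inv g U x x = 0"
proof (rule Exp_inv_eq[OF assms(1)])
  show "spray_curve (\<lambda>_. x) (\<lambda>_. 0)" by (simp add: spray_curve_def)
qed (use assms(2) in auto)

text \<open>The first-order condition of convexity along geodesics: the difference quotients of
  \<open>V\<close> along the geodesic at time 0 are at most \<open>V y - V x\<close>, and so is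
  their one-sided limit.\<close>

lemma g_convex_derivative_Exp_inv:
  assumes U: "g_convex_set g U" and V: "g_convex_fun g U V" and xy: "x \<in> U" "y \<in> U"
    and D: "(V has_derivative D) (at x)"
  shows "D (Exp_inv g U x y) \<le> V y - V x"
proof -
  obtain c where c: "spray_curve c (velocity c)" "c 0 = x" "c 1 = y" "c ` {0..1} \<subseteq> U"
    using spray_curve_to[OF U xy] by metis
  have E: "Exp_inv g U x y = velocity c 0" by (rule Exp_inv_eq[OF U c(1,4,2,3)])
  have "(c has_derivative (\<lambda>h. h *\<^sub>R velocity c 0)) (at 0 within {0..1})"
    using spray_curveD(1)[OF c(1), of 0] by (simp add: has_vector_derivative_def)
  from has_derivative_compose[OF this, of V D]
  have "((\<lambda>t. V (c t)) has_derivative (\<lambda>h. D (h *\<^sub>R velocity c 0))) (at 0 within {0..1})"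
    using D c(2) by simp
  then have "((\<lambda>t. V (c t)) has_real_derivative D (velocity c 0)) (at 0 within {0..1})"
    using linear_cmul[OF has_derivative_linear[OF D]]
    by (simp add: has_field_derivative_def mult.commute[of _ "D _"])
  then have lim: "((\<lambda>t. (V (c t) - V x) / t) \<longlongrightarrow> D (velocity c 0)) (at 0 within {0..1})"
    by (simp add: has_field_derivative_iff c(2))
  have "(V (c t) - V x) / t \<le> V y - V x" if "t \<in> {0..1}" "t \<noteq> 0" for t
  proof -
    have "(1 - t) * V x + t * V y \<ge> V (c t)"
      using V xy c that(1) unfolding g_convex_fun_def geodesic_in_iff_spray_curve by blast
    then show ?thesis using that by (simp add: field_simps)
  qed
  then have ev: "\<forall>\<^sub>F t in at 0 within {0..1}. (V (c t) - V x) / t \<le> V y - V x"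
    by (simp add: eventually_at_filter)
  have "at (0::real) within {0..1} \<noteq> bot" by (simp add: trivial_limit_within islimpt_Icc)
  from tendsto_upperbound[OF lim ev this] show ?thesis by (simp add: E)
qed

end

section \<open>From the convex Lyapunov function to the homotopy\<close>

lemma inner_gradient:
  fixes f :: "'a::euclidean_space \<Rightarrow> real"
  assumes f: "(f has_derivative D) (at x)"
  shows "gradient f x \<bullet> v = D v"
proof -
  define d where "d = (\<Sum>b\<in>Basis. D b *\<^sub>R b)"
  have D: "D = (\<lambda>h. h \<bullet> d)"
  proof
    fix h
    have "D h = D (\<Sum>b\<in>Basis. (h \<bullet> b) *\<^sub>R b)" by (simp add: euclidean_representation)
    also have "\<dots> = h \<bullet> d"
      by (simp add: d_def linear_sum[OF has_derivative_linear[OF f]]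
          linear_cmul[OF has_derivative_linear[OF f]] inner_sum_right mult.commute)
    finally show "D h = h \<bullet> d" .
  qed
  have "gradient f x = d"
    unfolding gradient_def
  proof (rule the_equality)
    show "GDERIV f x :> d" using f unfolding gderiv_def D .
    fix e assume "GDERIV f x :> e"
    then have "(\<lambda>h. h \<bullet> e) = (\<lambda>h. h \<bullet> d)"
      using f unfolding gderiv_def D by (rule has_derivative_unique)
    then show "e = d" by (metis inner_commute vector_eq_rdot)
  qed
  then show ?thesis by (simp add: D inner_commute)
qed

theorem mainTheorem5:
  fixes g :: "real^'n \<Rightarrow> real^'n \<Rightarrow> real^'n \<Rightarrow> real"
    and U :: "(real^'n) set"
    and F :: "real^'n \<Rightarrow> real^'n"
  assumes "riemannian_metric g"
    and "open U" and "g_convex_set g U" and "0 \<in> U"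
    and "continuous_on U F" and "complete_field U F"
    and "GAS_zero U F"
    and "\<exists>V. smooth_Lyapunov U F V \<and> g_convex_fun g U V"
  shows "continuous_on ({0..1} \<times> U) (\<lambda>(s, x). (1 - s) *\<^sub>R F x + s *\<^sub>R Exp_inv g U x 0) \<and>
         (\<forall>s\<in>{0..1}. GAS_zero U (\<lambda>x. (1 - s) *\<^sub>R F x + s *\<^sub>R Exp_inv g U x 0))"
proof -
  interpret riemannian g by standard (rule assms(1))
  let ?E = "\<lambda>x. Exp_inv g U x 0"
  note U = assms(2-4) and F = assms(5)
  obtain V where V: "smooth_Lyapunov U F V" and Vconv: "g_convex_fun g U V" using assms(8) by blast
  define DV where "DV x = frechet_derivative V (at x)" for x
  have "Ck_on (Suc 0) V U" using V unfolding smooth_Lyapunov_def Cinfinity_on_def by blast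
  then have DV: "\<And>x. x \<in> U \<Longrightarrow> (V has_derivative DV x) (at x)"
    and cDV: "\<And>v. continuous_on U (\<lambda>x. DV x v)"
    by (auto simp: DV_def frechet_derivative_works)
  have V0: "V 0 = 0" and pos: "\<And>x. x \<in> U - {0} \<Longrightarrow> V x > 0" and nn: "\<And>x. x \<in> U \<Longrightarrow> V x \<ge> 0"
    and neg: "\<And>x. x \<in> U - {0} \<Longrightarrow> DV x (F x) < 0"
    and cpt: "\<And>c. c \<ge> 0 \<Longrightarrow> compact {x\<in>U. V x \<le> c}"
    using V inner_gradient[OF DV] unfolding smooth_Lyapunov_def by auto
  have cV: "continuous_on U V"
    using DV has_derivative_continuous continuous_at_imp_continuous_on by blast
  \<comment> \<open>Convexity and \<open>V 0 = 0\<close> give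
    \<open>V (\<gamma> t) \<le> (1 - t) * V x \<le> V x\<close>, so geodesics to 0 never leave the
    sub-level set.\<close>
  have E_sub: "continuous_on {x\<in>U. V x \<le> c} ?E" if c: "c \<ge> 0" for c
  proof (rule continuous_on_Exp_inv[OF U(1,2) cpt[OF c] _ U(3)])
    fix x \<gamma> assume x: "x \<in> {x\<in>U. V x \<le> c}" and \<gamma>: "geodesic_in g U x 0 \<gamma>"
    show "\<gamma> ` {0..1} \<subseteq> {x\<in>U. V x \<le> c}"
    proof (intro image_subsetI CollectI conjI)
      fix t :: real assume t: "t \<in> {0..1}"
      show "\<gamma> t \<in> U" using \<gamma> t unfolding geodesic_in_def by blast
      have "V (\<gamma> t) \<le> (1 - t) * V x + t * V 0"
        using Vconv \<gamma> x U(3) t unfolding g_convex_fun_def by blast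
      also have "\<dots> \<le> 1 * V x" using mult_right_mono[of "1 - t" 1 "V x"] t nn x by (simp add: V0)
      finally show "V (\<gamma> t) \<le> c" using x by simp
    qed
  qed auto
  have E: "continuous_on U ?E"
  proof (rule continuous_at_imp_continuous_on, rule ballI)
    fix x assume x: "x \<in> U"
    \<comment> \<open>Continuity at \<open>x\<close> is local: the strict sub-level set of level
      \<open>V x + 1\<close> is an open neighbourhood of \<open>x\<close> inside a compact sub-level
      set.\<close>
    have "{y\<in>U. V y < V x + 1} = U \<inter> V -` {..<V x + 1}" by auto
    then have "open {y\<in>U. V y < V x + 1}"
      using continuous_open_preimage[OF cV U(1), of "{..<V x + 1}"] by simp
    moreover have "continuous_on {y\<in>U. V y < V x + 1} ?E"
      by (rule continuous_on_subset[OF E_sub[of "V x + 1"]]) (use nn[OF x] in auto)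
    moreover have "x \<in> {y\<in>U. V y < V x + 1}" using x by simp
    ultimately show "isCont ?E x" using continuous_on_eq_continuous_at by blast
  qed
  have homotopy: "continuous_on ({0..1} \<times> U) (\<lambda>a. (1 - fst a) *\<^sub>R F (snd a) + fst a *\<^sub>R ?E (snd a))"
    by (intro continuous_intros continuous_on_compose2[OF F] continuous_on_compose2[OF E]) auto
  have "GAS_zero U (\<lambda>x. (1 - s) *\<^sub>R F x + s *\<^sub>R ?E x)" if s: "s \<in> {0..1}" for s
  proof (rule Lyapunov_GAS_zero[OF U(1,3) _ _ DV _ V0 pos _ cpt])
    let ?G = "\<lambda>x. (1 - s) *\<^sub>R F x + s *\<^sub>R ?E x"
    show G: "continuous_on U ?G" by (intro continuous_intros F E)
    have "F 0 = 0" using assms(7) by (simp add: GAS_zero_def)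
    then show "?G 0 = 0" using Exp_inv_self[OF U(2,3)] by simp
    \<comment> \<open>The derivative of \<open>V\<close> is continuous for each fixed direction
      only, so the moving direction \<open>?G x\<close> is expanded in the basis.\<close>
    have "continuous_on U (\<lambda>x. \<Sum>b\<in>Basis. (?G x \<bullet> b) * DV x b)"
      by (intro continuous_intros G cDV)
    then show "continuous_on U (\<lambda>x. DV x (?G x))"
    proof (rule continuous_on_eq)
      fix x assume "x \<in> U"
      note lin = has_derivative_linear[OF DV[OF this]]
      have "DV x (?G x) = DV x (\<Sum>b\<in>Basis. (?G x \<bullet> b) *\<^sub>R b)" by (simp only: euclidean_representation)
      also have "\<dots> = (\<Sum>b\<in>Basis. (?G x \<bullet> b) * DV x b)" by (simp only: linear_sum[OF lin] linear_cmul[OF lin] real_scaleR_def)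
      finally show "(\<Sum>b\<in>Basis. (?G x \<bullet> b) * DV x b) = DV x (?G x)" by simp
    qed
    fix x assume x: "x \<in> U - {0}"
    then have "linear (DV x)" using has_derivative_linear[OF DV] by blast
    then have "DV x (?G x) = (1 - s) * DV x (F x) + s * DV x (?E x)"
      by (simp add: linear_add linear_cmul)
    moreover have "DV x (F x) < 0" by (rule neg[OF x])
    \<comment> \<open>Since \<open>V 0 = 0\<close>, the first-order condition bounds this by
      \<open>- V x\<close>.\<close>
    moreover have "DV x (?E x) < 0"
      using g_convex_derivative_Exp_inv[OF U(2) Vconv _ U(3) DV, of x] x pos[OF x] V0 by force
    ultimately show "DV x (?G x) < 0"
      using s convex_bound_lt[of "DV x (F x)" 0 "DV x (?E x)" "1 - s" s] by simp
  qed
  then show ?thesis using homotopy by (simp add: case_prod_unfold)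
qed

end
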